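(* A linear map $S:A\to A$ on a bimonoidal weak bialgebra $A$ is an antipode if and only if $S$ is a normal pre-rigidity map. In this case $S$ is always a bialgebra anti-automorphism and $S^{-1}$ is a pode.
   Context: $K$ is a field and all spaces are finite dimensional over $K$. A weak bialgebra $(A,1,\Delta,\varepsilon)$ is a unital associative $K$-algebra $(A,1)$ which is also a coassociative coalgebra with coproduct $\Delta$ and counit $\varepsilon$, such that $\Delta(ab)=\Delta(a)\Delta(b)$ for all $a,b$; neither $\Delta(1)=1\otimes1$ nor multiplicativity of $\varepsilon$ is required. Sweedler notation is used. $A$ is bimonoidal if $\varepsilon(abc)=\varepsilon(ab_{(1)})\varepsilon(b_{(2)}c)=\varepsilon(ab_{(2)})\varepsilon(b_{(1)}c)$ for all $a,b,c\in A$ (monoidal) and $(\Delta(1)\otimes1)(1\otimes\Delta(1))=1_{(1)}\otimes1_{(2)}\otimes1_{(3)}=(1\otimes\Delta(1))(\Delta(1)\otimes1)$ (comonoidal). Put $\varepsilon_{LL}(a)=\varepsilon(a1_{(1)})1_{(2)}$, $\varepsilon_{RR}(a)=1_{(1)}\varepsilon(1_{(2)}a)$, $\varepsilon_{LR}(a)=\varepsilon(1_{(1)}a)1_{(2)}$, $\varepsilon_{RL}(a)=1_{(1)}\varepsilon(a1_{(2)})$. An antipode is a linear map $S:A\to A$ with $a_{(1)}S(a_{(2)})=\varepsilon_{LR}(a)$, $S(a_{(1)})a_{(2)}=\varepsilon_{RL}(a)$ and $S(a_{(1)})a_{(2)}S(a_{(3)})=S(a)$ for all $a$. A pode is a linear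 map $\bar S:A\to A$ with $a_{(2)}\bar S(a_{(1)})=\varepsilon_{RR}(a)$, $\bar S(a_{(2)})a_{(1)}=\varepsilon_{LL}(a)$ and $\bar S(a_{(3)})a_{(2)}\bar S(a_{(1)})=\bar S(a)$ for all $a$. For a linear anti-multiplicative map $S:A\to A$ (i.e. $S(ab)=S(b)S(a)$) and $x,a\in A$ write $x\triangleleft_Sa=S(a_{(1)})xa_{(2)}$ and $a\,{}_S\!\triangleright x=a_{(1)}xS(a_{(2)})$. A pre-rigidity structure on a monoidal weak bialgebra is a triple $(S,\alpha,\beta)$ with $S:A\to A$ linear and anti-multiplicative and $\alpha,\beta\in A$ such that $\alpha\triangleleft_S1=\alpha$, $1\,{}_S\!\triangleright\beta=\beta$, and for all $a\in A$: $\alpha\triangleleft_Sa=\alpha\triangleleft_S\varepsilon_{RL}(a)$, $a\,{}_S\!\triangleright\beta=\varepsilon_{LR}(a)\,{}_S\!\triangleright\beta$. $S$ is a normal pre-rigidity map if $(S,1,1)$ is a pre-rigidity structure. A bialgebra anti-automorphism is a linear bijection that is anti-multiplicative and anti-comultiplicative, $\Delta(S(a))=S(a_{(2)})\otimes S(a_{(1)})$ (hence also preserves unit and counit). *)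

theory Defs
  imports Complex_Main "HOL-Library.Poly_Mapping"
begin

section \<open>Tensor powers of a vector space\<close>

text \<open>
  The tensor product \<open>V \<otimes> V\<close> of a vector space with itself is the free vector space on the set of
  pairs modulo the subspace spanned by the bilinearity relators; its elements are equivalence
  classes of formal linear combinations of pairs. Likewise \<open>V \<otimes> V \<otimes> V\<close>, with triples.
  The scalar multiplication of \<open>V\<close> is the parameter \<open>s\<close>.
\<close>

definition fscale :: "'k::field \<Rightarrow> ('b \<Rightarrow>\<^sub>0 'k) \<Rightarrow> ('b \<Rightarrow>\<^sub>0 'k)" where
  "fscale c t = Poly_Mapping.map ((*) c) t"

abbreviation gen :: "'b \<Rightarrow> ('b \<Rightarrow>\<^sub>0 'k::field)" where
  "gen p \<equiv> Poly_Mapping.single p 1"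

text \<open>The linear extension of \<open>f\<close> to the free vector space; \<open>s\<close> is the scalar multiplication
  of the target.\<close>

definition flin :: "('k::field \<Rightarrow> 'v \<Rightarrow> 'v) \<Rightarrow> ('b \<Rightarrow> 'v) \<Rightarrow> ('b \<Rightarrow>\<^sub>0 'k) \<Rightarrow> 'v::comm_monoid_add" where
  "flin s f t = (\<Sum>p\<in>Poly_Mapping.keys t. s (Poly_Mapping.lookup t p) (f p))"

definition relators2 :: "('k::field \<Rightarrow> 'a \<Rightarrow> 'a) \<Rightarrow> ('a::ab_group_add \<times> 'a \<Rightarrow>\<^sub>0 'k) set" where
  "relators2 s =
     {gen (x + x', y) - gen (x, y) - gen (x', y) | x x' y. True} \<union>
     {gen (x, y + y') - gen (x, y) - gen (x, y') | x y y'. True} \<union>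
     {gen (s c x, y) - fscale c (gen (x, y)) | c x y. True} \<union>
     {gen (x, s c y) - fscale c (gen (x, y)) | c x y. True}"

definition relators3 :: "('k::field \<Rightarrow> 'a \<Rightarrow> 'a) \<Rightarrow> ('a::ab_group_add \<times> 'a \<times> 'a \<Rightarrow>\<^sub>0 'k) set" where
  "relators3 s =
     {gen (x + x', y, z) - gen (x, y, z) - gen (x', y, z) | x x' y z. True} \<union>
     {gen (x, y + y', z) - gen (x, y, z) - gen (x, y', z) | x y y' z. True} \<union>
     {gen (x, y, z + z') - gen (x, y, z) - gen (x, y, z') | x y z z'. True} \<union>
     {gen (s c x, y, z) - fscale c (gen (x, y, z)) | c x y z. True} \<union>
     {gen (x, s c y, z) - fscale c (gen (x, y, z)) | c x y z. True} \<union>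
     {gen (x, y, s c z) - fscale c (gen (x, y, z)) | c x y z. True}"

definition teq2 :: "('k::field \<Rightarrow> 'a \<Rightarrow> 'a)
    \<Rightarrow> (('a::ab_group_add \<times> 'a \<Rightarrow>\<^sub>0 'k) \<times> ('a \<times> 'a \<Rightarrow>\<^sub>0 'k)) set" where
  "teq2 s = {(t, u). t - u \<in> module.span fscale (relators2 s)}"

definition teq3 :: "('k::field \<Rightarrow> 'a \<Rightarrow> 'a)
    \<Rightarrow> (('a::ab_group_add \<times> 'a \<times> 'a \<Rightarrow>\<^sub>0 'k) \<times> ('a \<times> 'a \<times> 'a \<Rightarrow>\<^sub>0 'k)) set" where
  "teq3 s = {(t, u). t - u \<in> module.span fscale (relators3 s)}"

definition tensor2 :: "('k::field \<Rightarrow> 'a \<Rightarrow> 'a) \<Rightarrow> ('a::ab_group_add \<times> 'a \<Rightarrow>\<^sub>0 'k)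
    \<Rightarrow> ('a \<times> 'a \<Rightarrow>\<^sub>0 'k) set" where
  "tensor2 s t = teq2 s `` {t}"

definition tensor3 :: "('k::field \<Rightarrow> 'a \<Rightarrow> 'a) \<Rightarrow> ('a::ab_group_add \<times> 'a \<times> 'a \<Rightarrow>\<^sub>0 'k)
    \<Rightarrow> ('a \<times> 'a \<times> 'a \<Rightarrow>\<^sub>0 'k) set" where
  "tensor3 s t = teq3 s `` {t}"

section \<open>Weak bialgebras\<close>

text \<open>The underlying space is the whole type \<open>'a\<close>, with its addition; the ground field is \<open>'k\<close>.\<close>

record (overloaded) ('k::zero, 'a) walg =
  smul :: "'k \<Rightarrow> 'a \<Rightarrow> 'a" (infixr "\<odot>\<index>" 75)
  mul :: "'a \<Rightarrow> 'a \<Rightarrow> 'a" (infixl "\<cdot>\<index>" 70)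
  unit :: 'a ("\<one>\<index>")
  comult :: "'a \<Rightarrow> ('a \<times> 'a \<Rightarrow>\<^sub>0 'k) set" ("\<Delta>\<index>")
  counit :: "'a \<Rightarrow> 'k" ("\<epsilon>\<index>")

text \<open>
  Sweedler notation: \<open>Delta_rep A a\<close> is a formal sum representing the tensor \<open>\<Delta>(a)\<close>, and
  \<open>sweedler s A f a\<close> is the sum written \<open>f(a\<^sub>(\<^sub>1\<^sub>), a\<^sub>(\<^sub>2\<^sub>))\<close>. For bilinear \<open>f\<close> it does not depend on
  the representative. The parameter \<open>s\<close> is the scalar multiplication of the target of \<open>f\<close>; when
  this is \<^const>\<open>fscale\<close>, the value is a formal sum, of which only the class in the tensor power
  matters.
\<close>

definition Delta_rep :: "('k::field, 'a::ab_group_add) walg \<Rightarrow> 'a \<Rightarrow> ('a \<times> 'a \<Rightarrow>\<^sub>0 'k)" where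
  "Delta_rep A a = (SOME t. t \<in> \<Delta>\<^bsub>A\<^esub> a)"

definition sweedler :: "('k::field \<Rightarrow> 'v \<Rightarrow> 'v) \<Rightarrow> ('k, 'a::ab_group_add) walg
    \<Rightarrow> ('a \<Rightarrow> 'a \<Rightarrow> 'v) \<Rightarrow> 'a \<Rightarrow> 'v::comm_monoid_add" where
  "sweedler s A f a = flin s (\<lambda>(x, y). f x y) (Delta_rep A a)"

text \<open>\<open>f(a\<^sub>(\<^sub>1\<^sub>), a\<^sub>(\<^sub>2\<^sub>), a\<^sub>(\<^sub>3\<^sub>))\<close>, computed from \<open>(\<Delta> \<otimes> id) \<Delta>(a)\<close>.\<close>

definition sweedler3 :: "('k::field \<Rightarrow> 'v \<Rightarrow> 'v) \<Rightarrow> ('k, 'a::ab_group_add) walg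
    \<Rightarrow> ('a \<Rightarrow> 'a \<Rightarrow> 'a \<Rightarrow> 'v) \<Rightarrow> 'a \<Rightarrow> 'v::comm_monoid_add" where
  "sweedler3 s A f a = sweedler s A (\<lambda>b z. sweedler s A (\<lambda>x y. f x y z) b) a"

text \<open>The componentwise products of \<open>A \<otimes> A\<close> and \<open>A \<otimes> A \<otimes> A\<close>, on representatives.\<close>

definition fmul2 :: "('k::field, 'a::ab_group_add) walg
    \<Rightarrow> ('a \<times> 'a \<Rightarrow>\<^sub>0 'k) \<Rightarrow> ('a \<times> 'a \<Rightarrow>\<^sub>0 'k) \<Rightarrow> ('a \<times> 'a \<Rightarrow>\<^sub>0 'k)" where
  "fmul2 A t u = flin fscale (\<lambda>(x, y). flin fscale (\<lambda>(x', y').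
     gen (x \<cdot>\<^bsub>A\<^esub> x', y \<cdot>\<^bsub>A\<^esub> y')) u) t"

definition fmul3 :: "('k::field, 'a::ab_group_add) walg
    \<Rightarrow> ('a \<times> 'a \<times> 'a \<Rightarrow>\<^sub>0 'k) \<Rightarrow> ('a \<times> 'a \<times> 'a \<Rightarrow>\<^sub>0 'k) \<Rightarrow> ('a \<times> 'a \<times> 'a \<Rightarrow>\<^sub>0 'k)" where
  "fmul3 A t u = flin fscale (\<lambda>(x, y, z). flin fscale (\<lambda>(x', y', z').
     gen (x \<cdot>\<^bsub>A\<^esub> x', y \<cdot>\<^bsub>A\<^esub> y', z \<cdot>\<^bsub>A\<^esub> z')) u) t"

definition fin_dim_space :: "('k::field, 'a::ab_group_add) walg \<Rightarrow> bool" where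
  "fin_dim_space A \<longleftrightarrow> vector_space (smul A) \<and> (\<exists>B. finite B \<and> module.span (smul A) B = UNIV)"

definition unital_algebra :: "('k::field, 'a::ab_group_add) walg \<Rightarrow> bool" where
  "unital_algebra A \<longleftrightarrow>
     (\<forall>a. Vector_Spaces.linear (smul A) (smul A) (\<lambda>x. a \<cdot>\<^bsub>A\<^esub> x)) \<and>
     (\<forall>a. Vector_Spaces.linear (smul A) (smul A) (\<lambda>x. x \<cdot>\<^bsub>A\<^esub> a)) \<and>
     (\<forall>a b c. (a \<cdot>\<^bsub>A\<^esub> b) \<cdot>\<^bsub>A\<^esub> c = a \<cdot>\<^bsub>A\<^esub> (b \<cdot>\<^bsub>A\<^esub> c)) \<and>
     (\<forall>a. \<one>\<^bsub>A\<^esub> \<cdot>\<^bsub>A\<^esub> a = a \<and> a \<cdot>\<^bsub>A\<^esub> \<one>\<^bsub>A\<^esub> = a)"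

definition counital_coalgebra :: "('k::field, 'a::ab_group_add) walg \<Rightarrow> bool" where
  "counital_coalgebra A \<longleftrightarrow>
     (\<forall>a. \<Delta>\<^bsub>A\<^esub> a \<in> UNIV // teq2 (smul A)) \<and>
     (\<forall>a b. \<Delta>\<^bsub>A\<^esub> (a + b) = tensor2 (smul A) (Delta_rep A a + Delta_rep A b)) \<and>
     (\<forall>c a. \<Delta>\<^bsub>A\<^esub> (c \<odot>\<^bsub>A\<^esub> a) = tensor2 (smul A) (fscale c (Delta_rep A a))) \<and>
     Vector_Spaces.linear (smul A) (*) (counit A) \<and>
     (\<forall>a. tensor3 (smul A) (sweedler fscale A (\<lambda>b z. sweedler fscale A (\<lambda>x y. gen (x, y, z)) b) a) =
          tensor3 (smul A) (sweedler fscale A (\<lambda>x b. sweedler fscale A (\<lambda>y z. gen (x, y, z)) b) a)) \<and>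
     (\<forall>a. sweedler (smul A) A (\<lambda>x y. \<epsilon>\<^bsub>A\<^esub> x \<odot>\<^bsub>A\<^esub> y) a = a) \<and>
     (\<forall>a. sweedler (smul A) A (\<lambda>x y. \<epsilon>\<^bsub>A\<^esub> y \<odot>\<^bsub>A\<^esub> x) a = a)"

definition weak_bialgebra :: "('k::field, 'a::ab_group_add) walg \<Rightarrow> bool" where
  "weak_bialgebra A \<longleftrightarrow> fin_dim_space A \<and> unital_algebra A \<and> counital_coalgebra A \<and>
     (\<forall>a b. \<Delta>\<^bsub>A\<^esub> (a \<cdot>\<^bsub>A\<^esub> b) = tensor2 (smul A) (fmul2 A (Delta_rep A a) (Delta_rep A b)))"

definition monoidal :: "('k::field, 'a::ab_group_add) walg \<Rightarrow> bool" where
  "monoidal A \<longleftrightarrow> (\<forall>a b c.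
     \<epsilon>\<^bsub>A\<^esub> (a \<cdot>\<^bsub>A\<^esub> b \<cdot>\<^bsub>A\<^esub> c) = sweedler (*) A (\<lambda>x y. \<epsilon>\<^bsub>A\<^esub> (a \<cdot>\<^bsub>A\<^esub> x) * \<epsilon>\<^bsub>A\<^esub> (y \<cdot>\<^bsub>A\<^esub> c)) b \<and>
     \<epsilon>\<^bsub>A\<^esub> (a \<cdot>\<^bsub>A\<^esub> b \<cdot>\<^bsub>A\<^esub> c) = sweedler (*) A (\<lambda>x y. \<epsilon>\<^bsub>A\<^esub> (a \<cdot>\<^bsub>A\<^esub> y) * \<epsilon>\<^bsub>A\<^esub> (x \<cdot>\<^bsub>A\<^esub> c)) b)"

definition comonoidal :: "('k::field, 'a::ab_group_add) walg \<Rightarrow> bool" where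
  "comonoidal A \<longleftrightarrow>
     (let D1 = sweedler fscale A (\<lambda>x y. gen (x, y, \<one>\<^bsub>A\<^esub>)) \<one>\<^bsub>A\<^esub>;
          D2 = sweedler fscale A (\<lambda>x y. gen (\<one>\<^bsub>A\<^esub>, x, y)) \<one>\<^bsub>A\<^esub>;
          T = tensor3 (smul A) (sweedler3 fscale A (\<lambda>x y z. gen (x, y, z)) \<one>\<^bsub>A\<^esub>)
      in tensor3 (smul A) (fmul3 A D1 D2) = T \<and> tensor3 (smul A) (fmul3 A D2 D1) = T)"

definition bimonoidal :: "('k::field, 'a::ab_group_add) walg \<Rightarrow> bool" where
  "bimonoidal A \<longleftrightarrow> monoidal A \<and> comonoidal A"

section \<open>Antipodes, podes and pre-rigidity structures\<close>

definition eps_LL :: "('k::field, 'a::ab_group_add) walg \<Rightarrow> 'a \<Rightarrow> 'a" where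
  "eps_LL A a = sweedler (smul A) A (\<lambda>x y. \<epsilon>\<^bsub>A\<^esub> (a \<cdot>\<^bsub>A\<^esub> x) \<odot>\<^bsub>A\<^esub> y) \<one>\<^bsub>A\<^esub>"

definition eps_RR :: "('k::field, 'a::ab_group_add) walg \<Rightarrow> 'a \<Rightarrow> 'a" where
  "eps_RR A a = sweedler (smul A) A (\<lambda>x y. \<epsilon>\<^bsub>A\<^esub> (y \<cdot>\<^bsub>A\<^esub> a) \<odot>\<^bsub>A\<^esub> x) \<one>\<^bsub>A\<^esub>"

definition eps_LR :: "('k::field, 'a::ab_group_add) walg \<Rightarrow> 'a \<Rightarrow> 'a" where
  "eps_LR A a = sweedler (smul A) A (\<lambda>x y. \<epsilon>\<^bsub>A\<^esub> (x \<cdot>\<^bsub>A\<^esub> a) \<odot>\<^bsub>A\<^esub> y) \<one>\<^bsub>A\<^esub>"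

definition eps_RL :: "('k::field, 'a::ab_group_add) walg \<Rightarrow> 'a \<Rightarrow> 'a" where
  "eps_RL A a = sweedler (smul A) A (\<lambda>x y. \<epsilon>\<^bsub>A\<^esub> (a \<cdot>\<^bsub>A\<^esub> y) \<odot>\<^bsub>A\<^esub> x) \<one>\<^bsub>A\<^esub>"

definition antipode :: "('k::field, 'a::ab_group_add) walg \<Rightarrow> ('a \<Rightarrow> 'a) \<Rightarrow> bool" where
  "antipode A S \<longleftrightarrow> Vector_Spaces.linear (smul A) (smul A) S \<and>
     (\<forall>a. sweedler (smul A) A (\<lambda>x y. x \<cdot>\<^bsub>A\<^esub> S y) a = eps_LR A a) \<and>
     (\<forall>a. sweedler (smul A) A (\<lambda>x y. S x \<cdot>\<^bsub>A\<^esub> y) a = eps_RL A a) \<and>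
     (\<forall>a. sweedler3 (smul A) A (\<lambda>x y z. S x \<cdot>\<^bsub>A\<^esub> y \<cdot>\<^bsub>A\<^esub> S z) a = S a)"

definition pode :: "('k::field, 'a::ab_group_add) walg \<Rightarrow> ('a \<Rightarrow> 'a) \<Rightarrow> bool" where
  "pode A S \<longleftrightarrow> Vector_Spaces.linear (smul A) (smul A) S \<and>
     (\<forall>a. sweedler (smul A) A (\<lambda>x y. y \<cdot>\<^bsub>A\<^esub> S x) a = eps_RR A a) \<and>
     (\<forall>a. sweedler (smul A) A (\<lambda>x y. S y \<cdot>\<^bsub>A\<^esub> x) a = eps_LL A a) \<and>
     (\<forall>a. sweedler3 (smul A) A (\<lambda>x y z. S z \<cdot>\<^bsub>A\<^esub> y \<cdot>\<^bsub>A\<^esub> S x) a = S a)"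

definition anti_multiplicative :: "('k::field, 'a::ab_group_add) walg \<Rightarrow> ('a \<Rightarrow> 'a) \<Rightarrow> bool" where
  "anti_multiplicative A S \<longleftrightarrow> (\<forall>a b. S (a \<cdot>\<^bsub>A\<^esub> b) = S b \<cdot>\<^bsub>A\<^esub> S a)"

definition anti_comultiplicative :: "('k::field, 'a::ab_group_add) walg \<Rightarrow> ('a \<Rightarrow> 'a) \<Rightarrow> bool" where
  "anti_comultiplicative A S \<longleftrightarrow>
     (\<forall>a. \<Delta>\<^bsub>A\<^esub> (S a) = tensor2 (smul A) (sweedler fscale A (\<lambda>x y. gen (S y, S x)) a))"

definition right_act :: "('k::field, 'a::ab_group_add) walg \<Rightarrow> ('a \<Rightarrow> 'a) \<Rightarrow> 'a \<Rightarrow> 'a \<Rightarrow> 'a" where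
  "right_act A S x a = sweedler (smul A) A (\<lambda>a1 a2. S a1 \<cdot>\<^bsub>A\<^esub> x \<cdot>\<^bsub>A\<^esub> a2) a"

definition left_act :: "('k::field, 'a::ab_group_add) walg \<Rightarrow> ('a \<Rightarrow> 'a) \<Rightarrow> 'a \<Rightarrow> 'a \<Rightarrow> 'a" where
  "left_act A S a x = sweedler (smul A) A (\<lambda>a1 a2. a1 \<cdot>\<^bsub>A\<^esub> x \<cdot>\<^bsub>A\<^esub> S a2) a"

definition pre_rigidity ::
    "('k::field, 'a::ab_group_add) walg \<Rightarrow> ('a \<Rightarrow> 'a) \<Rightarrow> 'a \<Rightarrow> 'a \<Rightarrow> bool" where
  "pre_rigidity A S \<alpha> \<beta> \<longleftrightarrow>
     Vector_Spaces.linear (smul A) (smul A) S \<and> anti_multiplicative A S \<and>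
     right_act A S \<alpha> \<one>\<^bsub>A\<^esub> = \<alpha> \<and> left_act A S \<one>\<^bsub>A\<^esub> \<beta> = \<beta> \<and>
     (\<forall>a. right_act A S \<alpha> a = right_act A S \<alpha> (eps_RL A a)) \<and>
     (\<forall>a. left_act A S a \<beta> = left_act A S (eps_LR A a) \<beta>)"

definition normal_pre_rigidity_map ::
    "('k::field, 'a::ab_group_add) walg \<Rightarrow> ('a \<Rightarrow> 'a) \<Rightarrow> bool" where
  "normal_pre_rigidity_map A S \<longleftrightarrow> pre_rigidity A S \<one>\<^bsub>A\<^esub> \<one>\<^bsub>A\<^esub>"

definition bialgebra_anti_automorphism ::
    "('k::field, 'a::ab_group_add) walg \<Rightarrow> ('a \<Rightarrow> 'a) \<Rightarrow> bool" where
  "bialgebra_anti_automorphism A S \<longleftrightarrow> Vector_Spaces.linear (smul A) (smul A) S \<and> bij S \<and>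
     anti_multiplicative A S \<and> anti_comultiplicative A S"

end

(* The unital subalgebras eps_LR(A) and eps_RL(A) commute, and comonoidality gives
   Delta(x) = 1_(1) (x) x 1_(2) = 1_(1) (x) 1_(2) x for x in eps_RL(A), and symmetrically for
   eps_LR(A). Hence a normal pre-rigidity map satisfies the antipode axioms by direct computation,
   and conversely an antipode is anti-multiplicative and anti-comultiplicative because convolution
   inverses (relative to the two counital maps) are unique.

   For bijectivity, let f be a right linear map over the image of S^n. Anti-comultiplicativity and
   f(b c) = f(b c_(1)) S(c_(2)) c_(3) = f(b c_(1) S(c_(2))) c_(3) = f(b) c show by descent on n that
   f is right A-linear. In finite dimension some even power E = S^(2n) is injective on its own
   image and maps it onto itself; the projection p of A onto the image of E along the kernel of E
   is right linear over that image because E is an algebra map. So p is right A-linear with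
   p(1) = 1, that is p = id, and S is bijective. Applying S to the pode axioms for its inverse
   yields the antipode axioms. *)

theory Submission
  imports Defs
begin

section \<open>Multilinear maps on formal tensors\<close>

abbreviation lin :: "('k::field \<Rightarrow> 'v \<Rightarrow> 'v) \<Rightarrow> ('k \<Rightarrow> 'w \<Rightarrow> 'w) \<Rightarrow> ('v::ab_group_add \<Rightarrow> 'w::ab_group_add) \<Rightarrow> bool"
  where "lin s t f \<equiv> Vector_Spaces.linear s t f"

lemma vector_space_field: "vector_space ((*) :: 'k::field \<Rightarrow> 'k \<Rightarrow> 'k)"
  by unfold_locales (simp_all add: algebra_simps)

lemma linI:
  assumes "vector_space s" "vector_space t"
    and "\<And>x y. f (x + y) = f x + f y" and "\<And>c x. f (s c x) = t c (f x)"
  shows "lin s t f"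
  using assms by (simp add: Vector_Spaces.linear_iff)

lemma linD:
  assumes "lin s t f"
  shows "vector_space s" "vector_space t" "f (x + y) = f x + f y" "f (s c x) = t c (f x)"
  using assms by (simp_all add: Vector_Spaces.linear_iff)

lemma lin_compose: "lin t u g \<Longrightarrow> lin s t f \<Longrightarrow> lin s u (\<lambda>x. g (f x))"
  by (simp add: Vector_Spaces.linear_iff)

lemma lin_sum: "lin s t f \<Longrightarrow> f (sum g X) = (\<Sum>x\<in>X. f (g x))"
proof -
  assume "lin s t f"
  then interpret Vector_Spaces.linear s t f .
  show ?thesis by (rule sum)
qed

section \<open>Linear extension to free vector spaces\<close>

lemma lookup_fscale: "Poly_Mapping.lookup (fscale c t) p = c * Poly_Mapping.lookup t p"
  by (simp add: fscale_def Poly_Mapping.map.rep_eq when_def)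

lemma vector_space_fscale: "vector_space (fscale :: 'k::field \<Rightarrow> ('b \<Rightarrow>\<^sub>0 'k) \<Rightarrow> _)"
  by unfold_locales (auto intro!: poly_mapping_eqI simp: lookup_fscale lookup_add algebra_simps)

lemma flin_superset:
  assumes "vector_space t" "finite X" "Poly_Mapping.keys u \<subseteq> X"
  shows "flin t f u = (\<Sum>p\<in>X. t (Poly_Mapping.lookup u p) (f p))"
proof -
  interpret vector_space t by fact
  show ?thesis
    unfolding flin_def
    by (rule sum.mono_neutral_left) (use assms in \<open>auto simp: in_keys_iff\<close>)
qed

lemma lin_flin:
  assumes "vector_space t"
  shows "lin fscale t (flin t f)"
proof (rule linI[OF vector_space_fscale assms])
  interpret vector_space t by fact
  fix u v c
  have "flin t f (u + v) = (\<Sum>p\<in>Poly_Mapping.keys u \<union> Poly_Mapping.keys v. t (Poly_Mapping.lookup (u + v) p) (f p))"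
    by (intro flin_superset assms) (auto dest: Poly_Mapping.keys_add[THEN subsetD])
  also have "\<dots> = (\<Sum>p\<in>Poly_Mapping.keys u \<union> Poly_Mapping.keys v. t (Poly_Mapping.lookup u p) (f p)) + (\<Sum>p\<in>Poly_Mapping.keys u \<union> Poly_Mapping.keys v. t (Poly_Mapping.lookup v p) (f p))"
    by (simp add: lookup_add scale_left_distrib sum.distrib)
  also have "\<dots> = flin t f u + flin t f v"
    by (simp add: flin_superset[OF assms, of "Poly_Mapping.keys u \<union> Poly_Mapping.keys v"])
  finally show "flin t f (u + v) = flin t f u + flin t f v" .
  have "flin t f (fscale c u) = (\<Sum>p\<in>Poly_Mapping.keys u. t (Poly_Mapping.lookup (fscale c u) p) (f p))"
    by (intro flin_superset assms) (auto simp: in_keys_iff lookup_fscale)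
  then show "flin t f (fscale c u) = t c (flin t f u)"
    by (simp add: lookup_fscale flin_def scale_sum_right)
qed

lemma flin_gen: "vector_space t \<Longrightarrow> flin t f (gen p) = f p"
proof -
  assume "vector_space t"
  then interpret vector_space t .
  show ?thesis by (simp add: flin_def)
qed

lemma lin_flin_comp:
  assumes "lin t t' L"
  shows "L (flin t f u) = flin t' (\<lambda>p. L (f p)) u"
  by (simp add: flin_def lin_sum[OF assms] linD[OF assms])

lemma flin_gen_id: "flin fscale gen u = (u :: 'b \<Rightarrow>\<^sub>0 'k::field)"
proof (rule poly_mapping_eqI)
  fix p
  have "lin fscale (*) (\<lambda>t :: 'b \<Rightarrow>\<^sub>0 'k. Poly_Mapping.lookup t p)"
    by (rule linI[OF vector_space_fscale vector_space_field]) (simp_all add: lookup_add lookup_fscale)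
  from lin_flin_comp[OF this, where f = gen and u = u]
  have "Poly_Mapping.lookup (flin fscale gen u) p = (\<Sum>q\<in>Poly_Mapping.keys u. Poly_Mapping.lookup u q * Poly_Mapping.lookup (gen q) p)"
    by (simp add: flin_def)
  also have "\<dots> = (\<Sum>q\<in>Poly_Mapping.keys u. if q = p then Poly_Mapping.lookup u p else 0)"
    by (intro sum.cong) (auto simp: lookup_single when_def)
  also have "\<dots> = Poly_Mapping.lookup u p" by (auto simp: in_keys_iff)
  finally show "Poly_Mapping.lookup (flin fscale gen u) p = Poly_Mapping.lookup u p" .
qed

section \<open>Bilinear and trilinear maps and their descent to tensor powers\<close>

definition bil ::
    "('k::field \<Rightarrow> 'v \<Rightarrow> 'v) \<Rightarrow> ('k \<Rightarrow> 'w \<Rightarrow> 'w) \<Rightarrow> ('v::ab_group_add \<Rightarrow> 'v \<Rightarrow> 'w::ab_group_add) \<Rightarrow> bool" where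
  "bil s t g \<longleftrightarrow> (\<forall>y. lin s t (\<lambda>x. g x y)) \<and> (\<forall>x. lin s t (\<lambda>y. g x y))"

definition tril ::
    "('k::field \<Rightarrow> 'v \<Rightarrow> 'v) \<Rightarrow> ('k \<Rightarrow> 'w \<Rightarrow> 'w) \<Rightarrow> ('v::ab_group_add \<Rightarrow> 'v \<Rightarrow> 'v \<Rightarrow> 'w::ab_group_add) \<Rightarrow> bool" where
  "tril s t h \<longleftrightarrow> (\<forall>y z. lin s t (\<lambda>x. h x y z)) \<and> (\<forall>x z. lin s t (\<lambda>y. h x y z)) \<and> (\<forall>x y. lin s t (\<lambda>z. h x y z))"

lemma bilD:
  assumes "bil s t g"
  shows "lin s t (\<lambda>x. g x y)" "lin s t (g x)"
    "g (x + x') y = g x y + g x' y" "g x (y + y') = g x y + g x y'"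
    "g (s c x) y = t c (g x y)" "g x (s c y) = t c (g x y)"
  using assms by (auto simp: bil_def Vector_Spaces.linear_iff)

lemma trilD:
  assumes "tril s t h"
  shows "lin s t (\<lambda>x. h x y z)" "lin s t (\<lambda>y. h x y z)" "lin s t (\<lambda>z. h x y z)"
    "h (x + x') y z = h x y z + h x' y z" "h x (y + y') z = h x y z + h x y' z"
    "h x y (z + z') = h x y z + h x y z'"
    "h (s c x) y z = t c (h x y z)" "h x (s c y) z = t c (h x y z)" "h x y (s c z) = t c (h x y z)"
  using assms by (auto simp: tril_def Vector_Spaces.linear_iff)

lemma flin_span_zero:
  assumes "lin fscale t L" and "\<And>u. u \<in> R \<Longrightarrow> L u = 0" and "u \<in> module.span fscale R"
  shows "L u = 0"
proof -
  interpret Vector_Spaces.linear fscale t L by fact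
  show ?thesis using assms(3) eq_0_on_span[of R u] assms(2) by auto
qed

lemma lin_diff: "lin s t f \<Longrightarrow> f (x - y) = f x - f y"
proof -
  assume "lin s t f"
  then interpret Vector_Spaces.linear s t f .
  show ?thesis by (rule diff)
qed

text \<open>A bilinear map sends each relator to zero, so its linear extension factors through the
  tensor square.\<close>

lemma flin_teq2:
  assumes "bil s t g" "(u, v) \<in> teq2 s"
  shows "flin t (\<lambda>(x, y). g x y) u = flin t (\<lambda>(x, y). g x y) v"
proof -
  have vt: "vector_space t" using assms by (auto simp: bil_def dest: linD)
  let ?L = "flin t (\<lambda>(x, y). g x y)"
  have L: "lin fscale t ?L" by (rule lin_flin[OF vt])
  have "?L (u - v) = 0"
  proof (rule flin_span_zero[OF L])
    show "u - v \<in> module.span fscale (relators2 s)" using assms by (simp add: teq2_def)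
  next
    fix w assume "w \<in> relators2 s"
    then show "?L w = 0"
      by (auto simp: relators2_def lin_diff[OF L] linD(4)[OF L] flin_gen[OF vt] bilD[OF assms(1)])
  qed
  then show ?thesis by (simp add: lin_diff[OF L])
qed

lemma flin_teq3:
  assumes "tril s t h" "(u, v) \<in> teq3 s"
  shows "flin t (\<lambda>(x, y, z). h x y z) u = flin t (\<lambda>(x, y, z). h x y z) v"
proof -
  have vt: "vector_space t" using assms by (auto simp: tril_def dest: linD)
  let ?L = "flin t (\<lambda>(x, y, z). h x y z)"
  have L: "lin fscale t ?L" by (rule lin_flin[OF vt])
  have "?L (u - v) = 0"
  proof (rule flin_span_zero[OF L])
    show "u - v \<in> module.span fscale (relators3 s)" using assms by (simp add: teq3_def)
  next
    fix w assume "w \<in> relators3 s"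
    then show "?L w = 0"
      by (auto simp: relators3_def lin_diff[OF L] linD(4)[OF L] flin_gen[OF vt] trilD[OF assms(1)])
  qed
  then show ?thesis by (simp add: lin_diff[OF L])
qed

section \<open>Equality of tensors and its detection by forms\<close>

lemma equiv_teq2:
  fixes s :: "'k::field \<Rightarrow> 'a::ab_group_add \<Rightarrow> 'a"
  shows "equiv UNIV (teq2 s)"
proof -
  interpret vector_space "fscale :: 'k \<Rightarrow> ('a \<times> 'a \<Rightarrow>\<^sub>0 'k) \<Rightarrow> _" by (rule vector_space_fscale)
  show ?thesis
  proof (rule equivI)
    show "refl (teq2 s)" by (auto simp: refl_on_def teq2_def span_zero)
    show "sym (teq2 s)"
      unfolding sym_def teq2_def using span_neg by fastforce
    show "trans (teq2 s)"
      unfolding trans_def teq2_def using span_add by fastforce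
  qed simp
qed

lemma tensor3_eqD:
  fixes s :: "'k::field \<Rightarrow> 'a::ab_group_add \<Rightarrow> 'a"
  shows "tensor3 s u = tensor3 s v \<Longrightarrow> (u, v) \<in> teq3 s"
proof -
  interpret vector_space "fscale :: 'k \<Rightarrow> ('a \<times> 'a \<times> 'a \<Rightarrow>\<^sub>0 'k) \<Rightarrow> _" by (rule vector_space_fscale)
  assume "tensor3 s u = tensor3 s v"
  moreover have "v \<in> tensor3 s v" by (simp add: tensor3_def teq3_def span_zero)
  ultimately show ?thesis by (auto simp: tensor3_def)
qed

text \<open>A basis \<open>B\<close> of the span of \<open>R\<close>, taken inside \<open>R\<close>,
  stays independent when \<open>v\<close> is added, so values on \<open>insert v B\<close> can be
  prescribed.\<close>

lemma separating_functional:
  assumes "vector_space s" "v \<notin> module.span s R"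
  obtains \<phi> where "lin s (*) \<phi>" "\<And>w. w \<in> R \<Longrightarrow> \<phi> w = 0" "\<phi> v = 1"
proof -
  interpret vector_space s by fact
  interpret K: vector_space "(*) :: 'a \<Rightarrow> 'a \<Rightarrow> 'a" by (rule vector_space_field)
  interpret vector_space_pair s "(*) :: 'a \<Rightarrow> 'a \<Rightarrow> 'a" ..
  obtain B where B: "B \<subseteq> R" "independent B" "R \<subseteq> span B"
    using maximal_independent_subset by blast
  then have v: "v \<notin> span B" using assms(2) span_mono by blast
  then have "independent (insert v B)" using B by (simp add: independent_insert)
  from linear_independent_extend[OF this, of "\<lambda>x. if x = v then 1 else 0"]
  obtain \<phi> where \<phi>: "lin s (*) \<phi>" "\<forall>x\<in>insert v B. \<phi> x = (if x = v then 1 else 0)" by blast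
  interpret \<phi>: Vector_Spaces.linear s "(*)" \<phi> by (rule \<phi>)
  have "\<phi> w = 0" if "w \<in> R" for w
  proof (rule \<phi>.eq_0_on_span)
    show "w \<in> span B" using B(3) that by blast
    show "\<phi> x = 0" if "x \<in> B" for x
      using that \<phi>(2) v span_base[of x B] by auto
  qed
  then show ?thesis using \<phi> by (intro that[of \<phi>]) auto
qed

text \<open>A functional that vanishes on the relators is a bilinear form when restricted to
  generators. Over a field such functionals detect everything outside the span of the relators, so
  scalar-valued tests suffice.\<close>

lemma teq2_by_bilinear_forms:
  assumes s: "vector_space s"
    and eq: "\<And>g. bil s (*) g \<Longrightarrow> flin (*) (\<lambda>(x, y). g x y) u = flin (*) (\<lambda>(x, y). g x y) v"
  shows "(u, v) \<in> teq2 s"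
proof (rule ccontr)
  assume "(u, v) \<notin> teq2 s"
  then have "u - v \<notin> module.span fscale (relators2 s)" by (simp add: teq2_def)
  then obtain \<phi> where \<phi>: "lin fscale (*) \<phi>" "\<And>w. w \<in> relators2 s \<Longrightarrow> \<phi> w = 0" "\<phi> (u - v) = 1"
    by (rule separating_functional[OF vector_space_fscale]) blast
  have "bil s (*) (\<lambda>x y. \<phi> (gen (x, y)))"
  proof -
    have "\<phi> (gen (x + x', y) - gen (x, y) - gen (x', y)) = 0"
      "\<phi> (gen (x, y + y') - gen (x, y) - gen (x, y')) = 0"
      "\<phi> (gen (s c x, y) - fscale c (gen (x, y))) = 0"
      "\<phi> (gen (x, s c y) - fscale c (gen (x, y))) = 0" for x x' y y' c
      by (rule \<phi>(2), unfold relators2_def, blast)+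
    then show ?thesis
      by (auto simp: bil_def lin_diff[OF \<phi>(1)] linD(3,4)[OF \<phi>(1)] algebra_simps
          intro!: linI s vector_space_field)
  qed
  from eq[OF this] have "flin (*) (\<lambda>p. \<phi> (gen p)) u = flin (*) (\<lambda>p. \<phi> (gen p)) v"
    by (simp add: case_prod_unfold)
  then have "\<phi> u = \<phi> v"
    unfolding lin_flin_comp[OF \<phi>(1), symmetric] flin_gen_id .
  then show False using \<phi>(3) by (simp add: lin_diff[OF \<phi>(1)])
qed

section \<open>Stable ranges of powers of an endomorphism\<close>

text \<open>As in Fitting's lemma: once the range of \<open>f ^^ n\<close> has least dimension,
  \<open>f ^^ n\<close> maps it onto itself, and in finite dimension onto implies injective.\<close>

lemma linear_funpow_range_stable:
  fixes s :: "'k::field \<Rightarrow> 'v::ab_group_add \<Rightarrow> 'v"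
  assumes "vector_space s" "finite B0" "module.span s B0 = UNIV" "lin s s f"
  obtains n where "0 < n" "inj_on (f ^^ n) (range (f ^^ n))" "\<And>k. range (f ^^ (n + k)) = range (f ^^ n)"
proof -
  interpret vector_space s by fact
  obtain B where B: "B \<subseteq> B0" "independent B" "span B = UNIV"
    using maximal_independent_subset[of B0] assms(3)
    by (metis span_superset span_mono span_span top.extremum_uniqueI)
  interpret F: finite_dimensional_vector_space s B
    by unfold_locales (use B assms(2) finite_subset in auto)
  have lf: "lin s s (f ^^ n)" for n
  proof (induction n)
    case 0 show ?case by (intro linI vector_space_axioms) auto
  next
    case (Suc n) then show ?case using lin_compose[OF assms(4) Suc] by (simp add: comp_def)
  qed
  have sub: "subspace (range (f ^^ n))" for n
  proof -
    interpret Vector_Spaces.linear s s "f ^^ n" by (rule lf)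
    show ?thesis by (rule subspace_image) simp
  qed
  \<comment> \<open>Minimising over positive exponents secures \<open>0 < n\<close>, so that a
    factor \<open>f\<close> can be split off the power.\<close>
  define n where "n = (ARG_MIN (\<lambda>n. dim (range (f ^^ n))) n. 0 < n)"
  have n0: "0 < n"
    unfolding n_def by (rule arg_min_natI[where k = 1]) simp
  have n: "dim (range (f ^^ n)) \<le> dim (range (f ^^ m))" if "0 < m" for m
    unfolding n_def by (rule arg_min_nat_le) (rule that)
  have rn: "range (f ^^ (n + k)) = range (f ^^ n)" for k
  proof (rule F.subspace_dim_equal)
    show "range (f ^^ (n + k)) \<subseteq> range (f ^^ n)" by (auto simp: funpow_add)
  qed (use sub n n0 in auto)
  let ?R = "range (f ^^ n)"
  interpret L: Vector_Spaces.linear s s "f ^^ n" by (rule lf)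
  obtain C where C: "C \<subseteq> ?R" "independent C" "?R \<subseteq> span C" "card C = dim ?R"
    using basis_exists by blast
  have R: "span C = ?R" using C sub span_subspace by blast
  have fC: "finite C" using C F.finiteI_independent by blast
  have im: "(f ^^ n) ` ?R = ?R"
    using rn[of n] by (auto simp: funpow_add image_comp)
  \<comment> \<open>A spanning set of \<open>?R\<close> with at most \<open>dim ?R\<close> elements
    has exactly that many and is independent; this makes \<open>f ^^ n\<close> injective on the
    basis \<open>C\<close>, hence on its span.\<close>
  have "?R = span ((f ^^ n) ` C)"
    using L.span_image[of C] by (simp add: R im)
  then have "card ((f ^^ n) ` C) \<ge> card C"
    using C(4) dim_le_card[of ?R "(f ^^ n) ` C"] fC by auto
  then have card: "card ((f ^^ n) ` C) = card C"
    using card_image_le[OF fC, of "f ^^ n"] by auto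
  then have inj: "inj_on (f ^^ n) C" using eq_card_imp_inj_on fC by blast
  have "independent ((f ^^ n) ` C)"
    by (rule F.card_le_dim_spanning[of _ ?R])
      (use C im card fC \<open>?R = span ((f ^^ n) ` C)\<close> in auto)
  then have "inj_on (f ^^ n) ?R"
    using L.inj_on_span_independent_image[OF _ inj] R by simp
  with n0 rn show ?thesis by (intro that)
qed

section \<open>Sweedler calculus in a bimonoidal weak bialgebra\<close>

locale bimonoidal_weak_bialgebra =
  fixes A :: "('k::field, 'a::ab_group_add) walg" (structure)
  assumes weak_bialgebra: "weak_bialgebra A" and bimonoidal: "bimonoidal A"
begin

abbreviation sw :: "('k \<Rightarrow> 'v \<Rightarrow> 'v) \<Rightarrow> 'a \<Rightarrow> ('a \<Rightarrow> 'a \<Rightarrow> 'v) \<Rightarrow> 'v::ab_group_add" where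
  "sw t a g \<equiv> sweedler t A g a"

text \<open>The target and the source counital maps.\<close>

abbreviation et where "et \<equiv> eps_LR A"
abbreviation es where "es \<equiv> eps_RL A"

lemma vs: "vector_space (smul A)"
  using weak_bialgebra by (simp add: weak_bialgebra_def fin_dim_space_def)

lemma lin_id: "lin (smul A) (smul A) (\<lambda>x. x)"
  by (intro linI vs) auto

lemma lin_mul_left: "lin s (smul A) f \<Longrightarrow> lin s (smul A) (\<lambda>x. a \<cdot> f x)"
  and lin_mul_right: "lin s (smul A) f \<Longrightarrow> lin s (smul A) (\<lambda>x. f x \<cdot> a)"
  using weak_bialgebra
  by (auto simp: weak_bialgebra_def unital_algebra_def intro: lin_compose[where g = "\<lambda>x. a \<cdot> x"]
      lin_compose[where g = "\<lambda>x. x \<cdot> a"])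

lemma mul_assoc: "a \<cdot> b \<cdot> c = a \<cdot> (b \<cdot> c)"
  and mul_one [simp]: "\<one> \<cdot> a = a" "a \<cdot> \<one> = a"
  using weak_bialgebra by (auto simp: weak_bialgebra_def unital_algebra_def)

lemma mul_smul [simp]: "(c \<odot> a) \<cdot> b = c \<odot> (a \<cdot> b)" "a \<cdot> (c \<odot> b) = c \<odot> (a \<cdot> b)"
  using linD(4)[OF lin_mul_right[OF lin_id]] linD(4)[OF lin_mul_left[OF lin_id]] by auto

lemma coalg: "counital_coalgebra A"
  using weak_bialgebra by (simp add: weak_bialgebra_def)

lemma lin_counit: "lin s (smul A) f \<Longrightarrow> lin s (*) (\<lambda>x. \<epsilon> (f x))"
  using coalg lin_compose[of "smul A" "(*)" "counit A"] by (auto simp: counital_coalgebra_def)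

lemma counit_smul [simp]: "\<epsilon> (c \<odot> a) = c * \<epsilon> a"
  using linD(4)[OF lin_counit[OF lin_id]] .

lemma lin_scale_vec:
  assumes "vector_space t" "lin s (*) k"
  shows "lin s t (\<lambda>x. t (k x) v)"
proof -
  interpret t: vector_space t by fact
  show ?thesis
    using linD[OF assms(2)] by (auto intro!: linI t.vector_space_axioms simp: t.scale_left_distrib)
qed

lemma lin_scale:
  assumes "lin s t f"
  shows "lin s t (\<lambda>x. t c (f x))"
proof -
  interpret t: vector_space t using linD[OF assms] by simp
  show ?thesis
    using linD[OF assms] by (auto intro!: linI simp: t.scale_right_distrib t.scale_scale mult.commute)
qed

lemma bilI: "(\<And>y. lin s t (\<lambda>x. g x y)) \<Longrightarrow> (\<And>x. lin s t (\<lambda>y. g x y)) \<Longrightarrow> bil s t g"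
  by (simp add: bil_def)

lemma trilI: "(\<And>y z. lin s t (\<lambda>x. h x y z)) \<Longrightarrow> (\<And>x z. lin s t (\<lambda>y. h x y z)) \<Longrightarrow>
    (\<And>x y. lin s t (\<lambda>z. h x y z)) \<Longrightarrow> tril s t h"
  by (simp add: tril_def)

lemma bil_lin:
  assumes "bil s t g"
  shows "lin r s f \<Longrightarrow> lin r t (\<lambda>x. g (f x) y)" "lin r s f \<Longrightarrow> lin r t (\<lambda>x. g y (f x))"
  using lin_compose[OF bilD(1)[OF assms]] lin_compose[OF bilD(2)[OF assms]] by auto

lemma sw_cong: "(\<And>x y. f x y = g x y) \<Longrightarrow> sw t a f = sw t a g"
  by (simp add: sweedler_def)

lemma lin_sw_out: "lin t t' L \<Longrightarrow> L (sw t a g) = sw t' a (\<lambda>x y. L (g x y))"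
  by (simp add: sweedler_def lin_flin_comp case_prod_unfold)

lemma lin_sw:
  assumes "vector_space r" "\<And>u v. lin r t (\<lambda>x. h x u v)" 
  shows "lin r t (\<lambda>x. sw t a (h x))"
proof -
  interpret t: vector_space t using linD[OF assms(2)] by simp
  show ?thesis
    unfolding sweedler_def flin_def
    by (rule linI) (auto simp: assms t.vector_space_axioms linD[OF assms(2)]
       t.scale_right_distrib t.scale_sum_right sum.distrib mult.commute case_prod_unfold intro!: sum.cong)
qed

lemma sw_swap:
  assumes "vector_space t"
  shows "sw t a (\<lambda>x y. sw t b (\<lambda>u v. h x y u v)) = sw t b (\<lambda>u v. sw t a (\<lambda>x y. h x y u v))"
proof -
  interpret t: vector_space t by fact
  show ?thesis
    unfolding sweedler_def flin_def case_prod_unfold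
    by (simp add: t.scale_sum_right mult.commute) (rule sum.swap)
qed

lemma Delta_class: "Delta_rep A a \<in> \<Delta> a" "\<Delta> a = tensor2 (smul A) (Delta_rep A a)"
proof -
  have D: "\<Delta> a \<in> UNIV // teq2 (smul A)" using coalg by (simp add: counital_coalgebra_def)
  then obtain u where u: "\<Delta> a = teq2 (smul A) `` {u}" by (auto simp: quotient_def)
  then have "\<exists>t. t \<in> \<Delta> a" using equiv_class_self[OF equiv_teq2] by auto
  then show 1: "Delta_rep A a \<in> \<Delta> a" unfolding Delta_rep_def by (rule someI_ex)
  then show "\<Delta> a = tensor2 (smul A) (Delta_rep A a)"
    using equiv_class_eq[OF equiv_teq2, of u "Delta_rep A a"] by (simp add: u tensor2_def)
qed

text \<open>Sweedler sums use one chosen representative of \<Delta>(a); bilinearity makes the choice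
  harmless, so any convenient \<open>u\<close> can replace it.\<close>

lemma sw_eq_flin:
  assumes "bil (smul A) t g" "\<Delta> a = tensor2 (smul A) u"
  shows "sw t a g = flin t (\<lambda>(x, y). g x y) u"
proof -
  have "(u, Delta_rep A a) \<in> teq2 (smul A)"
    using Delta_class(1)[of a] assms(2) by (simp add: tensor2_def)
  from flin_teq2[OF assms(1) this] show ?thesis by (simp add: sweedler_def)
qed

text \<open>\<open>Delta_rep\<close> itself need not be linear. Linearity holds for classes and
  becomes visible after pairing with a bilinear map.\<close>

lemma lin_sw_element: 
  assumes g: "bil (smul A) t g"
  shows "lin (smul A) t (\<lambda>a. sw t a g)"
proof -
  have vt: "vector_space t" using bilD(1)[OF g] linD by blast
  have L: "lin fscale t (flin t (\<lambda>(x, y). g x y))" by (rule lin_flin[OF vt])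
  show ?thesis
  proof (rule linI[OF vs vt])
    fix a b c
    have "\<Delta> (a + b) = tensor2 (smul A) (Delta_rep A a + Delta_rep A b)"
      "\<Delta> (c \<odot> a) = tensor2 (smul A) (fscale c (Delta_rep A a))"
      using coalg by (simp_all add: counital_coalgebra_def)
    from this[THEN sw_eq_flin[OF g]]
    show "sw t (a + b) g = sw t a g + sw t b g" "sw t (c \<odot> a) g = t c (sw t a g)"
      by (simp_all add: linD[OF L] sweedler_def)
  qed
qed

lemma lin_sw_arg: "lin r (smul A) f \<Longrightarrow> bil (smul A) t g \<Longrightarrow> lin r t (\<lambda>x. sw t (f x) g)"
  using lin_compose lin_sw_element by blast

lemma sw_mult:
  assumes g: "bil (smul A) t g"
  shows "sw t (a \<cdot> b) g = sw t a (\<lambda>x y. sw t b (\<lambda>u v. g (x \<cdot> u) (y \<cdot> v)))"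
proof -
  have vt: "vector_space t" using bilD(1)[OF g] linD by blast
  have L: "lin fscale t (flin t (\<lambda>(x, y). g x y))" by (rule lin_flin[OF vt])
  have "\<Delta> (a \<cdot> b) = tensor2 (smul A) (fmul2 A (Delta_rep A a) (Delta_rep A b))"
    using weak_bialgebra by (simp add: weak_bialgebra_def)
  from sw_eq_flin[OF g this] show ?thesis
    by (simp add: fmul2_def lin_flin_comp[OF L[unfolded case_prod_unfold]] case_prod_unfold flin_gen[OF vt] sweedler_def)
qed

lemma sw_coassoc:
  assumes h: "tril (smul A) t h"
  shows "sw t a (\<lambda>b z. sw t b (\<lambda>x y. h x y z)) = sw t a (\<lambda>x b. sw t b (\<lambda>y z. h x y z))"
proof -
  have vt: "vector_space t" using trilD(1)[OF h] linD by blast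
  have L: "lin fscale t (flin t (\<lambda>(x, y, z). h x y z))" by (rule lin_flin[OF vt])
  have "tensor3 (smul A) (sweedler fscale A (\<lambda>b z. sweedler fscale A (\<lambda>x y. gen (x, y, z)) b) a) =
          tensor3 (smul A) (sweedler fscale A (\<lambda>x b. sweedler fscale A (\<lambda>y z. gen (x, y, z)) b) a)"
    using coalg by (simp add: counital_coalgebra_def)
  from flin_teq3[OF h tensor3_eqD[OF this]] show ?thesis
    by (simp add: lin_sw_out[OF L] flin_gen[OF vt])
qed

lemma counit_left: "lin (smul A) t f \<Longrightarrow> sw t a (\<lambda>x y. t (\<epsilon> x) (f y)) = f a"
  and counit_right: "lin (smul A) t f \<Longrightarrow> sw t a (\<lambda>x y. t (\<epsilon> y) (f x)) = f a"
proof -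
  assume f: "lin (smul A) t f"
  have "sw (smul A) a (\<lambda>x y. \<epsilon> x \<odot> y) = a" "sw (smul A) a (\<lambda>x y. \<epsilon> y \<odot> x) = a"
    using coalg by (simp_all add: counital_coalgebra_def)
  from this[THEN arg_cong[where f = f]]
  show "sw t a (\<lambda>x y. t (\<epsilon> x) (f y)) = f a" "sw t a (\<lambda>x y. t (\<epsilon> y) (f x)) = f a"
    by (simp_all add: lin_sw_out[OF f] linD[OF f])
qed

text \<open>Comonoidality tested on trilinear maps. The outer legs are multiplied by \<one>, so only
  the middle leg carries a product, and the two claims differ in its order.\<close>

lemma comonoidal1:
  assumes h: "tril (smul A) t h"
  shows "sw t \<one> (\<lambda>x y. sw t \<one> (\<lambda>u v. h x (y \<cdot> u) v)) = sw t \<one> (\<lambda>b z. sw t b (\<lambda>x y. h x y z))"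
    and comonoidal2: "sw t \<one> (\<lambda>x y. sw t \<one> (\<lambda>u v. h x (u \<cdot> y) v)) = sw t \<one> (\<lambda>b z. sw t b (\<lambda>x y. h x y z))"
proof -
  have vt: "vector_space t" using trilD(1)[OF h] linD by blast
  have L: "lin fscale t (flin t (\<lambda>(x, y, z). h x y z))" by (rule lin_flin[OF vt])
  define D1 D2 :: "'a \<times> 'a \<times> 'a \<Rightarrow>\<^sub>0 'k" where "D1 = sweedler fscale A (\<lambda>x y. gen (x, y, \<one>)) \<one>"
    and "D2 = sweedler fscale A (\<lambda>x y. gen (\<one>, x, y)) \<one>"
  let ?T = "sweedler3 fscale A (\<lambda>x y z. gen (x, y, z)) \<one>"
  have eqs: "tensor3 (smul A) (fmul3 A D1 D2) = tensor3 (smul A) ?T"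
    "tensor3 (smul A) (fmul3 A D2 D1) = tensor3 (smul A) ?T"
    using bimonoidal by (simp_all add: bimonoidal_def comonoidal_def D1_def D2_def Let_def)
  have lf: "flin t F (sweedler fscale A G \<one>) = sw t \<one> (\<lambda>x y. flin t F (G x y))" for F :: "'a \<times> 'a \<times> 'a \<Rightarrow> _" and G
    by (rule lin_sw_out[OF lin_flin[OF vt]])
  have f3: "flin t (\<lambda>(x, y, z). h x y z) (fmul3 A u v) =
    flin t (\<lambda>(x, y, z). flin t (\<lambda>(x', y', z'). h (x \<cdot> x') (y \<cdot> y') (z \<cdot> z')) v) u" for u v
    by (simp add: fmul3_def lin_flin_comp[OF L[unfolded case_prod_unfold]] case_prod_unfold flin_gen[OF vt])
  note E = eqs[THEN tensor3_eqD, THEN flin_teq3[OF h], unfolded f3]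
  show "sw t \<one> (\<lambda>x y. sw t \<one> (\<lambda>u v. h x (y \<cdot> u) v)) = sw t \<one> (\<lambda>b z. sw t b (\<lambda>x y. h x y z))"
    using E(1) by (simp add: D1_def D2_def lf flin_gen[OF vt] lin_sw_out[OF L] sweedler3_def)
  have "sw t \<one> (\<lambda>u v. sw t \<one> (\<lambda>x y. h x (u \<cdot> y) v)) = sw t \<one> (\<lambda>b z. sw t b (\<lambda>x y. h x y z))"
    using E(2) by (simp add: D1_def D2_def lf flin_gen[OF vt] lin_sw_out[OF L] sweedler3_def)
  then show "sw t \<one> (\<lambda>x y. sw t \<one> (\<lambda>u v. h x (u \<cdot> y) v)) = sw t \<one> (\<lambda>b z. sw t b (\<lambda>x y. h x y z))"
    by (subst sw_swap[OF vt])
qed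

lemma monoidal1: "\<epsilon> (a \<cdot> (b \<cdot> c)) = sw (*) b (\<lambda>x y. \<epsilon> (a \<cdot> x) * \<epsilon> (y \<cdot> c))"
  and monoidal2: "\<epsilon> (a \<cdot> (b \<cdot> c)) = sw (*) b (\<lambda>x y. \<epsilon> (a \<cdot> y) * \<epsilon> (x \<cdot> c))"
  using bimonoidal unfolding bimonoidal_def monoidal_def mul_assoc[symmetric] by blast+

lemma lin_eps:
  assumes "lin s (smul A) f"
  shows "lin s (smul A) (\<lambda>x. et (f x))" "lin s (smul A) (\<lambda>x. es (f x))"
proof -
  have "lin (smul A) (smul A) et" "lin (smul A) (smul A) es"
    unfolding eps_LR_def eps_RL_def
    by (intro lin_sw vs lin_scale_vec lin_counit lin_mul_left lin_mul_right lin_id)+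
  from this[THEN lin_compose, OF assms]
  show "lin s (smul A) (\<lambda>x. et (f x))" "lin s (smul A) (\<lambda>x. es (f x))" by simp_all
qed

lemmas lin_intros = lin_id lin_mul_left lin_mul_right lin_counit lin_eps lin_sw[OF vs] lin_sw_arg
  lin_scale_vec lin_scale bilI trilI vs vector_space_field

lemma scale_sw: "vector_space t \<Longrightarrow> t c (sw t a g) = sw t a (\<lambda>x y. t c (g x y))"
proof (rule lin_sw_out[where L = "t c"])
  assume "vector_space t"
  then interpret vector_space t .
  show "lin t t (t c)" by (intro linI vector_space_axioms) (simp_all add: scale_right_distrib mult.commute)
qed

lemma sw_scale: "vector_space t \<Longrightarrow> t (sw (*) a k) v = sw t a (\<lambda>x y. t (k x y) v)"
proof (rule lin_sw_out[where L = "\<lambda>c. t c v"])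
  assume "vector_space t"
  then interpret vector_space t .
  show "lin (*) t (\<lambda>c. t c v)" by (intro linI vector_space_axioms vector_space_field) (simp_all add: scale_left_distrib)
qed

lemma mul_sw:
  "sw (smul A) a g \<cdot> b = sw (smul A) a (\<lambda>x y. g x y \<cdot> b)"
  "b \<cdot> sw (smul A) a g = sw (smul A) a (\<lambda>x y. b \<cdot> g x y)"
  by (rule lin_sw_out[where L = "\<lambda>x. x \<cdot> b"], intro lin_intros,
      rule lin_sw_out[where L = "\<lambda>x. b \<cdot> x"], intro lin_intros)

lemma counit_sw: "\<epsilon> (sw (smul A) a g) = sw (*) a (\<lambda>x y. \<epsilon> (g x y))"
  by (rule lin_sw_out, intro lin_intros)

lemma bil_sw:
  assumes "bil (smul A) t g"
  shows "g (sw (smul A) a f) z = sw t a (\<lambda>x y. g (f x y) z)"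
    "g z (sw (smul A) a f) = sw t a (\<lambda>x y. g z (f x y))"
  by (rule lin_sw_out[OF bilD(1)[OF assms]], rule lin_sw_out[OF bilD(2)[OF assms]])

lemmas sw_push = mul_sw counit_sw scale_sw[OF vs] sw_scale[OF vs] scale_sw[OF vector_space_field]
  sw_scale[OF vector_space_field]

lemma bil_vs: "bil s t g \<Longrightarrow> vector_space t"
  using bilD(1) linD by blast

lemma sw_unit_left: "bil (smul A) t g \<Longrightarrow> sw t \<one> (\<lambda>x y. sw t a (\<lambda>u v. g (x \<cdot> u) (y \<cdot> v))) = sw t a g"
  and sw_unit_right: "bil (smul A) t g \<Longrightarrow> sw t a (\<lambda>x y. sw t \<one> (\<lambda>u v. g (x \<cdot> u) (y \<cdot> v))) = sw t a g"
  by (simp_all flip: sw_mult)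

section \<open>The counital maps and the coproduct\<close>

text \<open>Applying \<epsilon>(a _) to the third leg of \<open>1_(1) (x) 1_(2) (x) 1_(3)\<close>
  gives \<Delta>(\<open>es a\<close>); the two comonoidal factorizations of this tensor give the two
  forms.\<close>

lemma sw_es:
  assumes g: "bil (smul A) t g"
  shows "sw t (es a) g = sw t \<one> (\<lambda>x y. g x (y \<cdot> es a))"
    and "sw t (es a) g = sw t \<one> (\<lambda>x y. g x (es a \<cdot> y))"
proof -
  note vt = bil_vs[OF g]
  have h: "tril (smul A) t (\<lambda>x y z. t (\<epsilon> (a \<cdot> z)) (g x y))"
    by (intro lin_intros bil_lin[OF g] vt)
  have 1: "sw t (es a) g = sw t \<one> (\<lambda>b z. sw t b (\<lambda>x y. t (\<epsilon> (a \<cdot> z)) (g x y)))"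
    unfolding eps_RL_def lin_sw_out[OF lin_sw_element[OF g]]
    by (simp add: linD(4)[OF lin_sw_element[OF g]] scale_sw[OF vt])
  show "sw t (es a) g = sw t \<one> (\<lambda>x y. g x (y \<cdot> es a))"
    unfolding 1 comonoidal1[OF h, symmetric]
    by (simp add: eps_RL_def sw_push bil_sw[OF g] bilD[OF g])
  show "sw t (es a) g = sw t \<one> (\<lambda>x y. g x (es a \<cdot> y))"
    unfolding 1 comonoidal2[OF h, symmetric]
    by (simp add: eps_RL_def sw_push bil_sw[OF g] bilD[OF g])
qed

text \<open>Mirror image of \<open>sw_es\<close>, with \<epsilon>(_ a) on the first leg;
  coassociativity brings the iterated coproduct into the form of the comonoidal identities.\<close>

lemma sw_et:
  assumes g: "bil (smul A) t g"
  shows "sw t (et a) g = sw t \<one> (\<lambda>x y. g (et a \<cdot> x) y)"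
    and "sw t (et a) g = sw t \<one> (\<lambda>x y. g (x \<cdot> et a) y)"
proof -
  note vt = bil_vs[OF g]
  have h: "tril (smul A) t (\<lambda>x y z. t (\<epsilon> (x \<cdot> a)) (g y z))"
    by (intro lin_intros bil_lin[OF g] vt)
  have 1: "sw t (et a) g = sw t \<one> (\<lambda>b z. sw t b (\<lambda>x y. t (\<epsilon> (x \<cdot> a)) (g y z)))"
    unfolding eps_LR_def lin_sw_out[OF lin_sw_element[OF g]] sw_coassoc[OF h]
    by (simp add: linD(4)[OF lin_sw_element[OF g]] scale_sw[OF vt])
  show "sw t (et a) g = sw t \<one> (\<lambda>x y. g (et a \<cdot> x) y)"
    by (subst 1, subst comonoidal1[OF h, symmetric], subst sw_swap[OF vt], rule sw_cong)
      (simp add: eps_LR_def sw_push bil_sw[OF g] bilD[OF g])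
  show "sw t (et a) g = sw t \<one> (\<lambda>x y. g (x \<cdot> et a) y)"
    by (subst 1, subst comonoidal2[OF h, symmetric], subst sw_swap[OF vt], rule sw_cong)
      (simp add: eps_LR_def sw_push bil_sw[OF g] bilD[OF g])
qed

text \<open>Applying \<epsilon>(_ b) and \<epsilon>(a _) to the outer legs of
  \<open>1_(1) (x) 1_(2) (x) 1_(3)\<close> leaves one element, and the two comonoidal factorizations
  write it as the product in either order.\<close>

lemma es_et_commute: "es a \<cdot> et b = et b \<cdot> es a"
proof -
  have h: "tril (smul A) (smul A) (\<lambda>x y z. \<epsilon> (x \<cdot> b) \<odot> (\<epsilon> (a \<cdot> z) \<odot> y))"
    by (intro lin_intros)
  note * = comonoidal1[OF h] comonoidal2[OF h]
  have "et b \<cdot> es a = sw (smul A) \<one> (\<lambda>u v. sw (smul A) \<one> (\<lambda>x y. \<epsilon> (x \<cdot> b) \<odot> (\<epsilon> (a \<cdot> v) \<odot> (y \<cdot> u))))"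
    by (simp add: eps_LR_def eps_RL_def sw_push vector_space.vector_space_assms(3)[OF vs] mult.commute)
  also have "\<dots> = sw (smul A) \<one> (\<lambda>x y. sw (smul A) \<one> (\<lambda>u v. \<epsilon> (x \<cdot> b) \<odot> (\<epsilon> (a \<cdot> v) \<odot> (y \<cdot> u))))"
    by (rule sw_swap[OF vs])
  also have "\<dots> = sw (smul A) \<one> (\<lambda>x y. sw (smul A) \<one> (\<lambda>u v. \<epsilon> (x \<cdot> b) \<odot> (\<epsilon> (a \<cdot> v) \<odot> (u \<cdot> y))))"
    unfolding * ..
  also have "\<dots> = es a \<cdot> et b"
    by (simp add: eps_LR_def eps_RL_def sw_push vector_space.vector_space_assms(3)[OF vs] mult.commute)
  finally show ?thesis by simp
qed

text \<open>A counit inserted on \<open>1_(1) a\<close> produces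
  \<epsilon>(\<open>1_(2) a_(2)\<close>) between \<open>1_(1) a_(1)\<close> and
  \<open>1_(3)\<close>. Comonoidality splits this into two copies of \<Delta>(1): one is absorbed by
  \<Delta>(a), the other forms \<open>et\<close>.\<close>

lemma sw_et_right:
  assumes g: "bil (smul A) t g"
  shows "sw t a (\<lambda>x y. g x (et y)) = sw t \<one> (\<lambda>x y. g (x \<cdot> a) y)"
proof -
  note vt = bil_vs[OF g]
  have h: "tril (smul A) t (\<lambda>x y z. sw t a (\<lambda>u v. t (\<epsilon> (y \<cdot> v)) (g (x \<cdot> u) z)))"
    by (intro lin_intros bil_lin[OF g] vt)
  have l: "lin (smul A) t (\<lambda>w. g w z)" for z by (intro lin_intros bil_lin[OF g])
  have b: "bil (smul A) t (\<lambda>p q. t (\<epsilon> q) (g p z))" for z by (intro lin_intros bil_lin[OF g] vt)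
  have b': "bil (smul A) t (\<lambda>p q. t (\<epsilon> (v \<cdot> q)) (g p z))" for z v by (intro lin_intros bil_lin[OF g] vt)
  have "sw t \<one> (\<lambda>x y. g (x \<cdot> a) y) = sw t \<one> (\<lambda>b z. sw t (b \<cdot> a) (\<lambda>p q. t (\<epsilon> q) (g p z)))"
    by (simp add: counit_right[OF l])
  also have "\<dots> = sw t \<one> (\<lambda>b z. sw t b (\<lambda>x y. sw t a (\<lambda>u v. t (\<epsilon> (y \<cdot> v)) (g (x \<cdot> u) z))))"
    by (simp add: sw_mult[OF b])
  also have "\<dots> = sw t \<one> (\<lambda>x y. sw t \<one> (\<lambda>p q. sw t a (\<lambda>u v. t (\<epsilon> (p \<cdot> (y \<cdot> v))) (g (x \<cdot> u) q))))"
    by (simp add: comonoidal2[OF h, symmetric] mul_assoc)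
  also have "\<dots> = sw t \<one> (\<lambda>p q. sw t \<one> (\<lambda>x y. sw t a (\<lambda>u v. t (\<epsilon> (p \<cdot> (y \<cdot> v))) (g (x \<cdot> u) q))))"
    by (rule sw_swap[OF vt])
  also have "\<dots> = sw t \<one> (\<lambda>p q. sw t a (\<lambda>u v. t (\<epsilon> (p \<cdot> v)) (g u q)))"
    by (simp add: sw_unit_left[OF b'])
  also have "\<dots> = sw t a (\<lambda>u v. sw t \<one> (\<lambda>p q. t (\<epsilon> (p \<cdot> v)) (g u q)))"
    by (rule sw_swap[OF vt])
  also have "\<dots> = sw t a (\<lambda>x y. g x (et y))"
    by (simp add: eps_LR_def bil_sw[OF g] bilD[OF g])
  finally show ?thesis by simp
qed

text \<open>Mirror image of \<open>sw_et_right\<close>, with the counit inserted on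
  \<open>a 1_(2)\<close>.\<close>

lemma sw_es_left:
  assumes g: "bil (smul A) t g"
  shows "sw t a (\<lambda>x y. g (es x) y) = sw t \<one> (\<lambda>x y. g x (a \<cdot> y))"
proof -
  note vt = bil_vs[OF g]
  have h: "tril (smul A) t (\<lambda>x y z. sw t a (\<lambda>u v. t (\<epsilon> (u \<cdot> y)) (g x (v \<cdot> z))))"
    by (intro lin_intros bil_lin[OF g] vt)
  have l: "lin (smul A) t (\<lambda>w. g z w)" for z by (intro lin_intros bil_lin[OF g])
  have b: "bil (smul A) t (\<lambda>p q. t (\<epsilon> p) (g z q))" for z by (intro lin_intros bil_lin[OF g] vt)
  have b': "bil (smul A) t (\<lambda>p q. t (\<epsilon> (p \<cdot> v)) (g z q))" for z v by (intro lin_intros bil_lin[OF g] vt)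
  have "sw t \<one> (\<lambda>x y. g x (a \<cdot> y)) = sw t \<one> (\<lambda>x b. sw t (a \<cdot> b) (\<lambda>p q. t (\<epsilon> p) (g x q)))"
    by (simp add: counit_left[OF l])
  also have "\<dots> = sw t \<one> (\<lambda>x b. sw t b (\<lambda>y z. sw t a (\<lambda>u v. t (\<epsilon> (u \<cdot> y)) (g x (v \<cdot> z)))))"
    by (simp add: sw_mult[OF b]) (subst sw_swap[OF vt], rule refl)
  also have "\<dots> = sw t \<one> (\<lambda>x y. sw t \<one> (\<lambda>p q. sw t a (\<lambda>u v. t (\<epsilon> ((u \<cdot> p) \<cdot> y)) (g x (v \<cdot> q)))))"
    by (simp add: sw_coassoc[OF h, symmetric] comonoidal2[OF h, symmetric] mul_assoc)
  also have "\<dots> = sw t \<one> (\<lambda>x y. sw t a (\<lambda>u v. sw t \<one> (\<lambda>p q. t (\<epsilon> ((u \<cdot> p) \<cdot> y)) (g x (v \<cdot> q)))))"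
    by (subst sw_swap[OF vt]) (rule refl)
  also have "\<dots> = sw t \<one> (\<lambda>x y. sw t a (\<lambda>u v. t (\<epsilon> (u \<cdot> y)) (g x v)))"
    by (simp only: sw_unit_right[OF b'])
  also have "\<dots> = sw t a (\<lambda>u v. sw t \<one> (\<lambda>x y. t (\<epsilon> (u \<cdot> y)) (g x v)))"
    by (rule sw_swap[OF vt])
  also have "\<dots> = sw t a (\<lambda>x y. g (es x) y)"
    by (simp add: eps_RL_def bil_sw[OF g] bilD[OF g])
  finally show ?thesis by simp
qed

text \<open>The counit on the first leg of \<Delta>(1)\<Delta>(a) recovers \<open>a\<close>, while
  the sum over \<Delta>(1) assembles \<open>et\<close>.\<close>

lemma et_mul_id: "sw (smul A) a (\<lambda>x y. et x \<cdot> y) = a"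
proof -
  have b: "bil (smul A) (smul A) (\<lambda>x y. \<epsilon> x \<odot> y)" by (intro lin_intros)
  have "a = sw (smul A) (\<one> \<cdot> a) (\<lambda>x y. \<epsilon> x \<odot> y)"
    by (simp add: counit_left[OF lin_id])
  also have "\<dots> = sw (smul A) a (\<lambda>x y. et x \<cdot> y)"
    by (subst sw_mult[OF b], subst sw_swap[OF vs], rule sw_cong) (simp add: eps_LR_def sw_push)
  finally show ?thesis by simp
qed

lemma mul_es_id: "sw (smul A) a (\<lambda>x y. x \<cdot> es y) = a"
proof -
  have b: "bil (smul A) (smul A) (\<lambda>x y. \<epsilon> y \<odot> x)" by (intro lin_intros)
  have "a = sw (smul A) (a \<cdot> \<one>) (\<lambda>x y. \<epsilon> y \<odot> x)"
    by (simp add: counit_right[OF lin_id])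
  also have "\<dots> = sw (smul A) a (\<lambda>x y. x \<cdot> es y)"
    by (subst sw_mult[OF b]) (simp add: eps_RL_def sw_push)
  finally show ?thesis by simp
qed

text \<open>\<open>et\<close> sees its argument only through the functionals \<epsilon>(x _), and
  the second monoidal axiom with middle argument \<one> makes these agree.\<close>

lemma et_mul_et: "et (a \<cdot> et b) = et (a \<cdot> b)"
proof -
  have "\<epsilon> (x \<cdot> (a \<cdot> et b)) = \<epsilon> (x \<cdot> (a \<cdot> b))" for x
    using monoidal2[of "x \<cdot> a" \<one> b] by (simp add: eps_LR_def sw_push mul_assoc mult.commute)
  then show ?thesis by (simp add: eps_LR_def[of A "a \<cdot> et b"] eps_LR_def[of A "a \<cdot> b"])
qed

lemma es_es_mul: "es (es a \<cdot> b) = es (a \<cdot> b)"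
proof -
  have "\<epsilon> (es a \<cdot> b \<cdot> x) = \<epsilon> (a \<cdot> b \<cdot> x)" for x
    using monoidal2[of a \<one> "b \<cdot> x"] by (simp add: eps_RL_def sw_push mul_assoc mult.commute)
  then show ?thesis by (simp add: eps_RL_def[of A "es a \<cdot> b"] eps_RL_def[of A "a \<cdot> b"])
qed

lemma et_one [simp]: "et \<one> = \<one>" and es_one [simp]: "es \<one> = \<one>"
  by (simp_all add: eps_LR_def eps_RL_def counit_left[OF lin_id] counit_right[OF lin_id])

text \<open>Places the legs of \<Delta>(1) in the images of \<open>es\<close> and \<open>et\<close>,
  by \<open>sw_et_right\<close> and \<open>sw_es_left\<close> at \<one>.\<close>

lemma sw_one_et: "bil (smul A) t g \<Longrightarrow> sw t \<one> (\<lambda>x y. g x (et y)) = sw t \<one> g"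
  and sw_one_es: "bil (smul A) t g \<Longrightarrow> sw t \<one> (\<lambda>x y. g (es x) y) = sw t \<one> g"
  by (simp_all add: sw_et_right sw_es_left)

section \<open>From pre-rigidity to the antipode axioms\<close>

text \<open>Pre-rigidity replaces \<open>a\<close> by a counital value, whose coproduct is
  \<Delta>(1) with one extra factor. That factor leaves the sum, and normalization removes the
  rest.\<close>

lemma normal_imp_antipode:
  assumes "normal_pre_rigidity_map A S"
  shows "antipode A S"
proof -
  have S: "lin (smul A) (smul A) S" and anti: "S (x \<cdot> y) = S y \<cdot> S x"
    and r1: "sw (smul A) \<one> (\<lambda>x y. S x \<cdot> y) = \<one>" and l1: "sw (smul A) \<one> (\<lambda>x y. x \<cdot> S y) = \<one>"
    and r: "sw (smul A) a (\<lambda>x y. S x \<cdot> y) = sw (smul A) (es a) (\<lambda>x y. S x \<cdot> y)"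
    and l: "sw (smul A) a (\<lambda>x y. x \<cdot> S y) = sw (smul A) (et a) (\<lambda>x y. x \<cdot> S y)" for a x y
    using assms by (simp_all add: normal_pre_rigidity_map_def pre_rigidity_def
        anti_multiplicative_def right_act_def left_act_def)
  note ints = lin_intros lin_compose[OF S]
  have bl: "bil (smul A) (smul A) (\<lambda>x y. S x \<cdot> y)" and br: "bil (smul A) (smul A) (\<lambda>x y. x \<cdot> S y)"
    by (intro ints)+
  have t: "tril (smul A) (smul A) (\<lambda>x y z. S x \<cdot> (y \<cdot> S z))" by (intro ints)
  have left: "sw (smul A) a (\<lambda>x y. S x \<cdot> y) = es a" for a
    unfolding r[of a] sw_es(1)[OF bl]
    using mul_sw(1)[where a = \<one> and g = "\<lambda>x y. S x \<cdot> y" and b = "es a"] by (simp add: r1 mul_assoc)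
  have right: "sw (smul A) a (\<lambda>x y. x \<cdot> S y) = et a" for a
    unfolding l[of a] sw_et(1)[OF br]
    using mul_sw(2)[where a = \<one> and g = "\<lambda>x y. x \<cdot> S y" and b = "et a"] by (simp add: l1 mul_assoc)
  have "sw (smul A) a (\<lambda>b z. sw (smul A) b (\<lambda>x y. S x \<cdot> y \<cdot> S z)) = S a" for a
  proof -
    have "sw (smul A) a (\<lambda>b z. sw (smul A) b (\<lambda>x y. S x \<cdot> y \<cdot> S z))
      = sw (smul A) a (\<lambda>x y. S x \<cdot> et y)"
      by (simp add: mul_assoc sw_coassoc[OF t] flip: mul_sw right)
    also have "\<dots> = sw (smul A) \<one> (\<lambda>x y. S (x \<cdot> a) \<cdot> y)"
      by (rule sw_et_right[OF bl])
    \<comment> \<open>\<open>S\<close> reverses \<open>1_(1) a\<close>, so \<open>S a\<close>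
      factors out on the left and \<open>S 1_(1) 1_(2) = 1\<close> remains.\<close>
    also have "\<dots> = S a" using mul_sw(2)[where a = \<one> and g = "\<lambda>x y. S x \<cdot> y" and b = "S a"] by (simp add: anti mul_assoc r1)
    finally show ?thesis .
  qed
  then show ?thesis by (simp add: antipode_def S left right sweedler3_def)
qed

section \<open>The antipode\<close>

end

locale weak_hopf_algebra = bimonoidal_weak_bialgebra A
  for A :: "('k::field, 'a::ab_group_add) walg" (structure) +
  fixes S :: "'a \<Rightarrow> 'a"
  assumes antipode: "antipode A S"
begin

section \<open>Convolution identities and anti-multiplicativity\<close>

lemma lin_S: "lin (smul A) (smul A) S"
  using antipode by (simp add: antipode_def)

lemmas ints = lin_intros lin_compose[OF lin_S]

lemma S_smul [simp]: "S (c \<odot> a) = c \<odot> S a"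
  by (rule linD(4)[OF lin_S])

lemma S_sw: "S (sw (smul A) a g) = sw (smul A) a (\<lambda>x y. S (g x y))"
  by (rule lin_sw_out[OF lin_S])

lemma mul_S: "sw (smul A) a (\<lambda>x y. x \<cdot> S y) = et a"
  and S_mul: "sw (smul A) a (\<lambda>x y. S x \<cdot> y) = es a"
  using antipode by (simp_all add: antipode_def)

text \<open>Two groupings of the third antipode axiom: the right or the left pair of factors
  collapses to a counital value.\<close>

lemma S_et: "sw (smul A) a (\<lambda>x y. S x \<cdot> et y) = S a"
  and es_S: "sw (smul A) a (\<lambda>x y. es x \<cdot> S y) = S a"
proof -
  have t: "tril (smul A) (smul A) (\<lambda>x y z. S x \<cdot> (y \<cdot> S z))" by (intro ints)
  have eq: "sw (smul A) a (\<lambda>b z. sw (smul A) b (\<lambda>x y. S x \<cdot> y \<cdot> S z)) = S a"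
    using antipode by (simp add: antipode_def sweedler3_def)
  show "sw (smul A) a (\<lambda>x y. es x \<cdot> S y) = S a" 
    using eq by (simp add: mul_sw flip: S_mul)
  show "sw (smul A) a (\<lambda>x y. S x \<cdot> et y) = S a"
    using eq by (simp add: mul_assoc sw_coassoc[OF t] mul_sw flip: mul_S)
qed

text \<open>\<open>et\<close> does not distinguish \<open>a b\<close> from \<open>a (et b)\<close>,
  and the coproduct of the latter is \<Delta>(a) with \<open>et b\<close> on the right of its first
  leg.\<close>

lemma mul_et_S: "sw (smul A) a (\<lambda>x y. x \<cdot> et b \<cdot> S y) = et (a \<cdot> b)"
proof -
  have b1: "bil (smul A) (smul A) (\<lambda>x y. x \<cdot> S y)"
    and b2: "bil (smul A) (smul A) (\<lambda>x y. x \<cdot> et b \<cdot> S y)"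
    and b3: "bil (smul A) (smul A) (\<lambda>p q. (u \<cdot> p) \<cdot> S (v \<cdot> q))" for u v
    by (intro ints)+
  have "et (a \<cdot> b) = sw (smul A) (a \<cdot> et b) (\<lambda>x y. x \<cdot> S y)"
    by (simp add: et_mul_et mul_S)
  also have "\<dots> = sw (smul A) a (\<lambda>u v. sw (smul A) \<one> (\<lambda>p q. (u \<cdot> p) \<cdot> et b \<cdot> S (v \<cdot> q)))"
    unfolding sw_mult[OF b1] sw_et(2)[OF b3] by (simp only: mul_assoc)
  also have "\<dots> = sw (smul A) a (\<lambda>x y. x \<cdot> et b \<cdot> S y)"
    by (rule sw_unit_right[OF b2])
  finally show ?thesis by simp
qed

lemma S_es_mul: "sw (smul A) b (\<lambda>x y. S x \<cdot> es a \<cdot> y) = es (a \<cdot> b)"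
proof -
  have b1: "bil (smul A) (smul A) (\<lambda>x y. S x \<cdot> y)"
    and b2: "bil (smul A) (smul A) (\<lambda>x y. S x \<cdot> es a \<cdot> y)"
    and b3: "bil (smul A) (smul A) (\<lambda>p q. sw (smul A) b (\<lambda>u v. S (p \<cdot> u) \<cdot> (q \<cdot> v)))"
    by (intro ints)+
  have "es (a \<cdot> b) = sw (smul A) (es a \<cdot> b) (\<lambda>x y. S x \<cdot> y)"
    by (simp add: es_es_mul S_mul)
  also have "\<dots> = sw (smul A) \<one> (\<lambda>p q. sw (smul A) b (\<lambda>u v. S (p \<cdot> u) \<cdot> es a \<cdot> (q \<cdot> v)))"
    unfolding sw_mult[OF b1] sw_es(2)[OF b3] by (simp only: mul_assoc)
  also have "\<dots> = sw (smul A) b (\<lambda>x y. S x \<cdot> es a \<cdot> y)"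
    by (rule sw_unit_left[OF b2])
  finally show ?thesis by simp
qed

text \<open>In the convolution algebra of maps \<open>A \<otimes> A \<rightarrow> A\<close>, with \<open>m\<close> the product, \<open>F(a \<otimes> b) = S(ab)\<close> and
  \<open>G(a \<otimes> b) = S(b)S(a)\<close> satisfy \<open>F * m = G * m\<close> and \<open>m * F = m * G\<close>, so that
  \<open>F = F * m * F = G * m * G = G\<close>.\<close>

lemma S_anti: "S (a \<cdot> b) = S b \<cdot> S a"
proof -
  have b1: "bil (smul A) (smul A) (\<lambda>x y. S x \<cdot> et y)" by (intro ints)
  have t1: "tril (smul A) (smul A) (\<lambda>x p q. S (x \<cdot> u) \<cdot> (p \<cdot> et v \<cdot> S q))" for u v by (intro ints)
  have t2: "tril (smul A) (smul A) (\<lambda>u r s. S (x \<cdot> u) \<cdot> (y \<cdot> r \<cdot> S s))" for x y by (intro ints)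
  have t3: "tril (smul A) (smul A) (\<lambda>r s v. S r \<cdot> es x \<cdot> s \<cdot> S v)" for x by (intro ints)
  have b4: "bil (smul A) (smul A) (\<lambda>x y. S x \<cdot> y)" by (intro ints)
  let ?s = "sw (smul A)"
  have "S (a \<cdot> b) = ?s a (\<lambda>x y. ?s b (\<lambda>u v. S (x \<cdot> u) \<cdot> et (y \<cdot> v)))"
    unfolding sw_mult[OF b1, symmetric] by (simp only: S_et)
  also have "\<dots> = ?s b (\<lambda>u v. ?s a (\<lambda>x y. ?s y (\<lambda>p q. S (x \<cdot> u) \<cdot> (p \<cdot> et v \<cdot> S q))))"
    by (subst sw_swap[OF vs]) (simp add: mul_sw flip: mul_et_S)
  also have "\<dots> = ?s b (\<lambda>u v. ?s a (\<lambda>w q. ?s w (\<lambda>x y. S (x \<cdot> u) \<cdot> (y \<cdot> et v \<cdot> S q))))"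
    by (simp only: sw_coassoc[OF t1])
  also have "\<dots> = ?s a (\<lambda>w q. ?s w (\<lambda>x y. ?s b (\<lambda>u v. S (x \<cdot> u) \<cdot> (y \<cdot> et v)) \<cdot> S q))"
    by (subst sw_swap[OF vs], intro sw_cong, subst sw_swap[OF vs]) (simp add: mul_sw mul_assoc)
  also have "\<dots> = ?s a (\<lambda>w q. ?s w (\<lambda>x y. ?s b (\<lambda>u v. ?s v (\<lambda>r s. S (x \<cdot> u) \<cdot> (y \<cdot> r \<cdot> S s)))) \<cdot> S q)"
    by (simp add: mul_sw mul_assoc flip: mul_S)
  also have "\<dots> = ?s a (\<lambda>w q. ?s w (\<lambda>x y. ?s b (\<lambda>u s. ?s u (\<lambda>u r. S (x \<cdot> u) \<cdot> (y \<cdot> r \<cdot> S s)))) \<cdot> S q)"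
    by (simp only: sw_coassoc[OF t2])
  also have "\<dots> = ?s a (\<lambda>w q. ?s b (\<lambda>c s. ?s w (\<lambda>x y. ?s c (\<lambda>u r. S (x \<cdot> u) \<cdot> (y \<cdot> r \<cdot> S s)))) \<cdot> S q)"
    by (intro sw_cong arg_cong[where f = "\<lambda>z. z \<cdot> c" for c] sw_swap[OF vs])
  also have "\<dots> = ?s a (\<lambda>w q. ?s b (\<lambda>c s. ?s w (\<lambda>x y. ?s c (\<lambda>u r. S (x \<cdot> u) \<cdot> (y \<cdot> r)))  \<cdot> S s) \<cdot> S q)"
    by (simp add: mul_sw mul_assoc)
  also have "\<dots> = ?s a (\<lambda>w q. ?s b (\<lambda>c s. es (w \<cdot> c) \<cdot> S s) \<cdot> S q)"
    by (simp add: sw_mult[OF b4] flip: S_mul)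
  \<comment> \<open>Here F * m, which has collapsed to \<open>es (w \<cdot> c)\<close>, is replaced
    by G * m.\<close>
  also have "\<dots> = ?s a (\<lambda>w q. ?s b (\<lambda>c v. ?s c (\<lambda>r s. S r \<cdot> es w \<cdot> s \<cdot> S v)) \<cdot> S q)"
    by (simp add: mul_sw flip: S_es_mul)
  also have "\<dots> = ?s a (\<lambda>w q. ?s b (\<lambda>r c. ?s c (\<lambda>s v. S r \<cdot> es w \<cdot> s \<cdot> S v)) \<cdot> S q)"
    by (simp only: sw_coassoc[OF t3])
  also have "\<dots> = ?s a (\<lambda>w q. ?s b (\<lambda>r c. S r \<cdot> (es w \<cdot> et c)) \<cdot> S q)"
    by (simp add: mul_sw mul_assoc flip: mul_S)
  \<comment> \<open>Commuting the two counital values separates the sum over \<open>b\<close> from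
    the sum over \<open>a\<close>.\<close>
  also have "\<dots> = ?s b (\<lambda>r c. S r \<cdot> et c) \<cdot> ?s a (\<lambda>w q. es w \<cdot> S q)"
    by (simp add: es_et_commute mul_sw mul_assoc)
  also have "\<dots> = S b \<cdot> S a" by (simp add: S_et es_S)
  finally show ?thesis .
qed

section \<open>The antipode on counital values\<close>

lemma S_mul_one: "sw (smul A) \<one> (\<lambda>x y. S x \<cdot> y) = \<one>"
  and mul_S_one: "sw (smul A) \<one> (\<lambda>x y. x \<cdot> S y) = \<one>"
  by (simp_all add: S_mul mul_S)

text \<open>\<Delta>(\<open>et a\<close>) is \<Delta>(1) with \<open>et a\<close> on the right of
  the first leg, so in \<open>S_mul\<close> the factor \<open>S (et a)\<close> comes out on the
  left.\<close>

lemma S_on_et: "S (et a) = es (et a)"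
proof -
  have b: "bil (smul A) (smul A) (\<lambda>x y. S x \<cdot> y)" by (intro ints)
  have "es (et a) = sw (smul A) \<one> (\<lambda>x y. S (x \<cdot> et a) \<cdot> y)"
    unfolding sw_et(2)[OF b, symmetric] by (simp add: S_mul)
  also have "\<dots> = S (et a) \<cdot> sw (smul A) \<one> (\<lambda>x y. S x \<cdot> y)"
    by (simp add: S_anti mul_assoc mul_sw)
  finally show ?thesis by (simp add: S_mul_one)
qed

lemma S_on_es: "S (es a) = et (es a)"
proof -
  have b: "bil (smul A) (smul A) (\<lambda>x y. x \<cdot> S y)" by (intro ints)
  have "et (es a) = sw (smul A) \<one> (\<lambda>x y. x \<cdot> S (es a \<cdot> y))"
    unfolding sw_es(2)[OF b, symmetric] by (simp add: mul_S)
  also have "\<dots> = sw (smul A) \<one> (\<lambda>x y. x \<cdot> S y) \<cdot> S (es a)"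
    by (simp add: S_anti mul_assoc mul_sw)
  finally show ?thesis by (simp add: mul_S_one)
qed

lemma S_one: "S \<one> = \<one>"
  using S_on_et[of \<one>] by simp

text \<open>The antipode axioms identify the two actions on \<one> with \<open>es\<close> and
  \<open>et\<close>; what remains is that these maps are idempotent.\<close>

lemma antipode_imp_normal: "normal_pre_rigidity_map A S"
proof -
  have "es (es a) = es a" "et (et a) = et a" for a
    using es_es_mul[of a \<one>] et_mul_et[of \<one> a] by simp_all
  then show ?thesis
    by (simp add: normal_pre_rigidity_map_def pre_rigidity_def anti_multiplicative_def lin_S
        right_act_def left_act_def S_mul mul_S S_anti)
qed

section \<open>Anti-comultiplicativity, tested on bilinear maps\<close>

text \<open>Anti-comultiplicativity at \<one>, needed for the general case. With its legs in the
  images of \<open>es\<close> and \<open>et\<close>, \<open>S\<close> acts on \<Delta>(1) by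
  \<open>et\<close> and \<open>es\<close>, which expand through the counit.\<close>

lemma sw_one_S_flip:
  assumes g: "bil (smul A) t g"
  shows "sw t \<one> (\<lambda>x y. g (S y) (S x)) = sw t \<one> g"
proof -
  note vt = bil_vs[OF g]
  have b1: "bil (smul A) t (\<lambda>x y. g (S y) (S x))" and b2: "bil (smul A) t (\<lambda>x y. g (S (et y)) (S x))"
    and b3: "bil (smul A) t (\<lambda>x y. g (es y) (et x))" and b4: "bil (smul A) t (\<lambda>x y. g (es (et y)) (et x))"
    by (intro ints bil_lin[OF g])+
  have h: "tril (smul A) t (\<lambda>x y z. t (\<epsilon> y) (g x z))"
    by (intro ints bil_lin[OF g] vt)
  have l: "lin (smul A) t (\<lambda>x. g x y)" for y by (intro ints bil_lin[OF g])
  interpret t: vector_space t by (rule vt)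
  have "sw t \<one> (\<lambda>x y. g (S y) (S x)) = sw t \<one> (\<lambda>x y. g (S (et y)) (S (es x)))"
    by (simp only: sw_one_et[OF b1] sw_one_es[OF b2])
  also have "\<dots> = sw t \<one> (\<lambda>x y. g (es (et y)) (et (es x)))"
    by (simp add: S_on_et S_on_es)
  also have "\<dots> = sw t \<one> (\<lambda>x y. g (es y) (et x))"
    by (simp only: sw_one_es[OF b4] sw_one_et[OF b3])
  also have "\<dots> = sw t \<one> (\<lambda>x y. sw t \<one> (\<lambda>p q. sw t \<one> (\<lambda>u v. t (\<epsilon> (p \<cdot> x) * \<epsilon> (y \<cdot> v)) (g u q))))"
    by (simp add: eps_LR_def eps_RL_def bil_sw[OF g] bilD[OF g] scale_sw[OF vt] mult.commute)
  also have "\<dots> = sw t \<one> (\<lambda>x y. sw t \<one> (\<lambda>u v. sw t \<one> (\<lambda>p q. t (\<epsilon> (p \<cdot> x) * \<epsilon> (y \<cdot> v)) (g u q))))"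
    by (intro sw_cong sw_swap[OF vt])
  also have "\<dots> = sw t \<one> (\<lambda>u v. sw t \<one> (\<lambda>x y. sw t \<one> (\<lambda>p q. t (\<epsilon> (p \<cdot> x) * \<epsilon> (y \<cdot> v)) (g u q))))"
    by (rule sw_swap[OF vt])
  also have "\<dots> = sw t \<one> (\<lambda>u v. sw t \<one> (\<lambda>p q. sw t \<one> (\<lambda>x y. t (\<epsilon> (p \<cdot> x) * \<epsilon> (y \<cdot> v)) (g u q))))"
    by (intro sw_cong sw_swap[OF vt])
  \<comment> \<open>Monoidality at \<one> joins the two counits when \<open>x\<close> and
    \<open>y\<close> are summed.\<close>
  also have "\<dots> = sw t \<one> (\<lambda>u v. sw t \<one> (\<lambda>p q. t (\<epsilon> (p \<cdot> v)) (g u q)))"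
    using monoidal1[of _ \<one>, symmetric] by (simp only: sw_scale[OF vt, symmetric] mul_one)
  also have "\<dots> = sw t \<one> (\<lambda>b z. sw t b (\<lambda>x y. t (\<epsilon> y) (g x z)))"
    by (rule comonoidal2[OF h])
  also have "\<dots> = sw t \<one> g"
    by (simp add: counit_right[OF l])
  finally show ?thesis .
qed

text \<open>The dual of the argument for \<open>S_anti\<close>, now in the convolution algebra of maps
  \<open>A \<rightarrow> A \<otimes> A\<close>, with \<open>\<Delta>\<close> in the place of \<open>m\<close>.\<close>

lemma sw_S:
  assumes g: "bil (smul A) t g"
  shows "sw t (S a) g = sw t a (\<lambda>x y. g (S y) (S x))"
proof -
  note vt = bil_vs[OF g]
  \<comment> \<open>The flipped coproduct followed by \<open>S\<close> on both legs is inverse to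
    \<Delta> from the right: their convolution product at \<open>b\<close> is
    \<Delta>(\<open>et b\<close>).\<close>
  have ds: "sw t (et b) h = sw t b (\<lambda>u v. sw t u (\<lambda>c d. sw t v (\<lambda>e f. h (c \<cdot> S f) (d \<cdot> S e))))"
    if h: "bil (smul A) t h" for h b
  proof -
    have t1: "tril (smul A) t (\<lambda>c d v. sw t v (\<lambda>e f. h (c \<cdot> S f) (d \<cdot> S e)))"
      and t2: "tril (smul A) t (\<lambda>d e f. h (c \<cdot> S f) (d \<cdot> S e))" 
      and t3: "tril (smul A) t (\<lambda>c n f. h (c \<cdot> S f) (et n))" 
      and b4: "bil (smul A) t (\<lambda>c n. h (c \<cdot> S f) n)" for c f
      by (intro ints bil_lin[OF h])+
    have "sw t b (\<lambda>u v. sw t u (\<lambda>c d. sw t v (\<lambda>e f. h (c \<cdot> S f) (d \<cdot> S e))))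
      = sw t b (\<lambda>c w. sw t w (\<lambda>d v. sw t v (\<lambda>e f. h (c \<cdot> S f) (d \<cdot> S e))))"
      by (rule sw_coassoc[OF t1])
    also have "\<dots> = sw t b (\<lambda>c w. sw t w (\<lambda>n f. sw t n (\<lambda>d e. h (c \<cdot> S f) (d \<cdot> S e))))"
      by (simp only: sw_coassoc[OF t2])
    also have "\<dots> = sw t b (\<lambda>c w. sw t w (\<lambda>n f. h (c \<cdot> S f) (et n)))"
      by (simp only: bil_sw[OF h, symmetric] mul_S)
    also have "\<dots> = sw t b (\<lambda>k f. sw t k (\<lambda>c n. h (c \<cdot> S f) (et n)))"
      by (rule sw_coassoc[OF t3, symmetric])
    also have "\<dots> = sw t b (\<lambda>k f. sw t \<one> (\<lambda>x y. h (x \<cdot> k \<cdot> S f) y))"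
      by (simp only: sw_et_right[OF b4])
    also have "\<dots> = sw t \<one> (\<lambda>x y. sw t b (\<lambda>k f. h (x \<cdot> k \<cdot> S f) y))"
      by (rule sw_swap[OF vt])
    also have "\<dots> = sw t \<one> (\<lambda>x y. h (x \<cdot> et b) y)"
      by (simp only: bil_sw[OF h, symmetric] mul_sw[symmetric] mul_S mul_assoc)
    also have "\<dots> = sw t (et b) h"
      by (rule sw_et(2)[OF h, symmetric])
    finally show ?thesis by simp
  qed
  have b1: "bil (smul A) t (\<lambda>r s. g (p \<cdot> r) (q \<cdot> s))" for p q by (intro ints bil_lin[OF g])
  have t1: "tril (smul A) t (\<lambda>x u v. sw t (S x) (\<lambda>p q. sw t u (\<lambda>c d. sw t v (\<lambda>e f. g (p \<cdot> (c \<cdot> S f)) (q \<cdot> (d \<cdot> S e))))))"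
    by (intro ints bil_lin[OF g])
  have b2: "bil (smul A) t (\<lambda>p q. g (p \<cdot> S f) (q \<cdot> S e))" for e f by (intro ints bil_lin[OF g])
  have b2': "bil (smul A) t (\<lambda>p q. sw t v (\<lambda>e f. g (p \<cdot> S f) (q \<cdot> S e)))" for v by (intro ints bil_lin[OF g])
  have l3: "lin (smul A) t (\<lambda>n. sw t n h)" if "bil (smul A) t h" for h by (intro ints that)
  have t4: "tril (smul A) t (\<lambda>k e f. sw t \<one> (\<lambda>r s. g (r \<cdot> S f) (s \<cdot> (es k \<cdot> S e))))"
    by (intro ints bil_lin[OF g])
  have b5: "bil (smul A) t (\<lambda>r s. g (r \<cdot> x) (s \<cdot> y))" for x y by (intro ints bil_lin[OF g])
  have b6: "bil (smul A) t (\<lambda>x y. g (S y) (S x))" by (intro ints bil_lin[OF g])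
  let ?s = "sw t"
  have "?s (S a) g = ?s a (\<lambda>x y. ?s (S x \<cdot> et y) g)"
    by (subst S_et[symmetric]) (rule lin_sw_out[OF l3[OF g]])
  also have "\<dots> = ?s a (\<lambda>x y. ?s (S x) (\<lambda>p q. ?s y (\<lambda>u v. ?s u (\<lambda>c d. ?s v (\<lambda>e f. g (p \<cdot> (c \<cdot> S f)) (q \<cdot> (d \<cdot> S e)))))))"
    by (simp only: sw_mult[OF g] ds[OF b1])
  also have "\<dots> = ?s a (\<lambda>x y. ?s y (\<lambda>u v. ?s (S x) (\<lambda>p q. ?s u (\<lambda>c d. ?s v (\<lambda>e f. g (p \<cdot> (c \<cdot> S f)) (q \<cdot> (d \<cdot> S e)))))))"
    by (intro sw_cong sw_swap[OF vt])
  also have "\<dots> = ?s a (\<lambda>k v. ?s k (\<lambda>x u. ?s (S x) (\<lambda>p q. ?s u (\<lambda>c d. ?s v (\<lambda>e f. g (p \<cdot> c \<cdot> S f) (q \<cdot> d \<cdot> S e))))))"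
    by (simp only: sw_coassoc[OF t1] mul_assoc)
  \<comment> \<open>From the left, \<Delta> after \<open>S\<close>, convolved with \<Delta>, becomes
    \<Delta>(\<open>es k\<close>) by multiplicativity.\<close>
  also have "\<dots> = ?s a (\<lambda>k v. ?s k (\<lambda>x u. ?s (S x \<cdot> u) (\<lambda>p q. ?s v (\<lambda>e f. g (p \<cdot> S f) (q \<cdot> S e)))))"
    by (simp only: sw_mult[OF b2'])
  also have "\<dots> = ?s a (\<lambda>k v. ?s (es k) (\<lambda>p q. ?s v (\<lambda>e f. g (p \<cdot> S f) (q \<cdot> S e))))"
    by (simp only: lin_sw_out[OF l3[OF b2'], symmetric] S_mul)
  also have "\<dots> = ?s a (\<lambda>k v. ?s \<one> (\<lambda>r s. ?s v (\<lambda>e f. g (r \<cdot> S f) (s \<cdot> (es k \<cdot> S e)))))"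
    by (simp only: sw_es(1)[OF b2'] mul_assoc)
  also have "\<dots> = ?s a (\<lambda>k v. ?s v (\<lambda>e f. ?s \<one> (\<lambda>r s. g (r \<cdot> S f) (s \<cdot> (es k \<cdot> S e)))))"
    by (intro sw_cong sw_swap[OF vt])
  also have "\<dots> = ?s a (\<lambda>n f. ?s n (\<lambda>k e. ?s \<one> (\<lambda>r s. g (r \<cdot> S f) (s \<cdot> (es k \<cdot> S e)))))"
    by (rule sw_coassoc[OF t4, symmetric])
  also have "\<dots> = ?s a (\<lambda>n f. ?s \<one> (\<lambda>r s. ?s n (\<lambda>k e. g (r \<cdot> S f) (s \<cdot> (es k \<cdot> S e)))))"
    by (intro sw_cong sw_swap[OF vt])
  also have "\<dots> = ?s a (\<lambda>n f. ?s \<one> (\<lambda>r s. g (r \<cdot> S f) (s \<cdot> S n)))"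
    by (simp only: bil_sw[OF g, symmetric] mul_sw[symmetric] es_S)
  \<comment> \<open>\<open>sw_one_S_flip\<close> puts \<Delta>(1) under \<open>S\<close>, where
    \<Delta>(a)\<Delta>(1) = \<Delta>(a) absorbs it.\<close>
  also have "\<dots> = ?s a (\<lambda>n f. ?s \<one> (\<lambda>r s. g (S (f \<cdot> s)) (S (n \<cdot> r))))"
    by (simp only: S_anti sw_one_S_flip[OF b5])
  also have "\<dots> = ?s a (\<lambda>n f. g (S f) (S n))"
    by (rule sw_unit_right[OF b6])
  finally show ?thesis .
qed

section \<open>The antipode and the remaining counital maps\<close>

text \<open>The leg \<open>1_(2)\<close> may be taken in the image of \<open>et\<close>, where
  \<open>S\<close> acts as \<open>es\<close>; monoidality at \<one> then merges the counits. This
  links the pode axioms to the antipode axioms.\<close>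

lemma S_eps_LL: "S (eps_LL A a) = es a"
proof -
  have b: "bil (smul A) (smul A) (\<lambda>x y. \<epsilon> (a \<cdot> x) \<odot> S y)"
    and b': "bil (smul A) (smul A) (\<lambda>x y. \<epsilon> (a \<cdot> x) \<odot> es y)" by (intro ints)+
  have "S (eps_LL A a) = sw (smul A) \<one> (\<lambda>x y. \<epsilon> (a \<cdot> x) \<odot> S y)"
    by (simp add: eps_LL_def S_sw)
  also have "\<dots> = sw (smul A) \<one> (\<lambda>x y. \<epsilon> (a \<cdot> x) \<odot> es y)"
    by (simp only: sw_one_et[OF b, symmetric] sw_one_et[OF b', symmetric] S_on_et)
  also have "\<dots> = sw (smul A) \<one> (\<lambda>x y. sw (smul A) \<one> (\<lambda>u v. (\<epsilon> (a \<cdot> x) * \<epsilon> (y \<cdot> v)) \<odot> u))"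
    by (simp add: eps_RL_def sw_push vector_space.vector_space_assms(3)[OF vs])
  also have "\<dots> = sw (smul A) \<one> (\<lambda>u v. sw (smul A) \<one> (\<lambda>x y. (\<epsilon> (a \<cdot> x) * \<epsilon> (y \<cdot> v)) \<odot> u))"
    by (rule sw_swap[OF vs])
  also have "\<dots> = es a"
    using monoidal1[of a \<one>, symmetric] by (simp only: sw_scale[OF vs, symmetric] mul_one eps_RL_def)
  finally show ?thesis .
qed

lemma S_eps_RR: "S (eps_RR A a) = et a"
proof -
  have b: "bil (smul A) (smul A) (\<lambda>x y. \<epsilon> (y \<cdot> a) \<odot> S x)"
    and b': "bil (smul A) (smul A) (\<lambda>x y. \<epsilon> (y \<cdot> a) \<odot> et x)" by (intro ints)+
  have "S (eps_RR A a) = sw (smul A) \<one> (\<lambda>x y. \<epsilon> (y \<cdot> a) \<odot> S x)"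
    by (simp add: eps_RR_def S_sw)
  also have "\<dots> = sw (smul A) \<one> (\<lambda>x y. \<epsilon> (y \<cdot> a) \<odot> et x)"
    by (simp only: sw_one_es[OF b, symmetric] sw_one_es[OF b', symmetric] S_on_es)
  also have "\<dots> = sw (smul A) \<one> (\<lambda>x y. sw (smul A) \<one> (\<lambda>u v. (\<epsilon> (u \<cdot> x) * \<epsilon> (y \<cdot> a)) \<odot> v))"
    by (simp add: eps_LR_def sw_push vector_space.vector_space_assms(3)[OF vs] mult.commute)
  also have "\<dots> = sw (smul A) \<one> (\<lambda>u v. sw (smul A) \<one> (\<lambda>x y. (\<epsilon> (u \<cdot> x) * \<epsilon> (y \<cdot> a)) \<odot> v))"
    by (rule sw_swap[OF vs])
  also have "\<dots> = et a"
    using monoidal1[of _ \<one> a, symmetric] by (simp only: sw_scale[OF vs, symmetric] mul_one eps_LR_def)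
  finally show ?thesis .
qed

lemma et_eps_LL: "et (eps_LL A a) = eps_LL A a"
proof -
  have b: "bil (smul A) (smul A) (\<lambda>x y. \<epsilon> (a \<cdot> x) \<odot> y)" by (intro ints)
  show ?thesis
    using sw_one_et[OF b] linD(4)[OF lin_eps(1)[OF lin_id]]
    by (simp add: eps_LL_def lin_sw_out[OF lin_eps(1)[OF lin_id]])
qed

lemma es_eps_RR: "es (eps_RR A a) = eps_RR A a"
proof -
  have b: "bil (smul A) (smul A) (\<lambda>x y. \<epsilon> (y \<cdot> a) \<odot> x)" by (intro ints)
  show ?thesis
    using sw_one_es[OF b] linD(4)[OF lin_eps(2)[OF lin_id]]
    by (simp add: eps_RR_def lin_sw_out[OF lin_eps(2)[OF lin_id]])
qed

subsection \<open>Bijectivity\<close>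

text \<open>\<open>S\<close> exchanges the two counital images: each value of \<open>es\<close> is
  \<open>S\<close> of a value of \<open>et\<close>, and vice versa.\<close>

lemma eps_in_range: "es a \<in> range (S ^^ n) \<and> et a \<in> range (S ^^ n)"
proof (induction n arbitrary: a)
  case (Suc n)
  have "S x \<in> range (S ^^ Suc n)" if "x \<in> range (S ^^ n)" for x
    using that by auto
  moreover have "es a = S (et (eps_LL A a))" "et a = S (es (eps_RR A a))"
    by (simp_all add: et_eps_LL es_eps_RR S_eps_LL S_eps_RR)
  ultimately show ?case
    using Suc by simp_all
qed auto

lemma lin_funpow_S: "lin (smul A) (smul A) (S ^^ n)"
proof (induction n)
  case 0 show ?case using lin_id by (simp add: id_def)
next
  case (Suc n) then show ?case using lin_compose[OF lin_S Suc] by (simp add: comp_def)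
qed

text \<open>Equivalent to \<open>\<Delta>(C) \<subseteq> C \<otimes> C\<close> when \<open>C\<close> is a subspace, tested on bilinear maps.\<close>

definition subcoalgebra :: "'a set \<Rightarrow> bool" where
  "subcoalgebra C \<longleftrightarrow> (\<forall>c\<in>C. \<forall>g h. bil (smul A) (smul A) g \<longrightarrow> bil (smul A) (smul A) h \<longrightarrow>
     (\<forall>x\<in>C. \<forall>y\<in>C. g x y = h x y) \<longrightarrow> sw (smul A) c g = sw (smul A) c h)"

lemma subcoalgebraD:
  assumes "subcoalgebra C" "c \<in> C" "bil (smul A) (smul A) g" "bil (smul A) (smul A) h"
    and "\<And>x y. x \<in> C \<Longrightarrow> y \<in> C \<Longrightarrow> g x y = h x y"
  shows "sw (smul A) c g = sw (smul A) c h"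
  using assms unfolding subcoalgebra_def by blast

text \<open>By \<open>sw_S\<close>, a test on \<open>S d\<close> is a test on \<open>d\<close> with
  legs flipped and sent through \<open>S\<close>, which is the preceding power.\<close>

lemma subcoalgebra_range_S: "subcoalgebra (range (S ^^ n))"
proof (induction n)
  case 0 show ?case by (auto simp: subcoalgebra_def intro: sw_cong)
next
  case (Suc n)
  show ?case
    unfolding subcoalgebra_def
  proof (intro ballI allI impI)
    fix c g h
    assume c: "c \<in> range (S ^^ Suc n)" and g: "bil (smul A) (smul A) g" and h: "bil (smul A) (smul A) h"
      and eq: "\<forall>x\<in>range (S ^^ Suc n). \<forall>y\<in>range (S ^^ Suc n). g x y = h x y"
    from c obtain d where d: "c = S d" "d \<in> range (S ^^ n)" by auto
    have b: "bil (smul A) (smul A) (\<lambda>x y. g (S y) (S x))" "bil (smul A) (smul A) (\<lambda>x y. h (S y) (S x))"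
      by (intro ints bil_lin[OF g] bil_lin[OF h])+
    have "\<forall>x\<in>range (S ^^ n). \<forall>y\<in>range (S ^^ n). g (S y) (S x) = h (S y) (S x)"
      using eq by auto
    then have "sw (smul A) d (\<lambda>x y. g (S y) (S x)) = sw (smul A) d (\<lambda>x y. h (S y) (S x))"
      by (intro subcoalgebraD[OF Suc d(2) b]) blast
    then show "sw (smul A) c g = sw (smul A) c h"
      by (simp add: d(1) sw_S[OF g] sw_S[OF h])
  qed
qed

text \<open>One step of the descent. Since the legs of \<open>c\<close> stay in \<open>C\<close>,
  \<open>fS\<close> moves \<open>S\<close> of a leg through \<open>f\<close>; \<open>eps\<close>
  does the same for counital factors.\<close>

lemma right_linear_step:
  assumes C: "subcoalgebra C" and eps: "\<And>a. es a \<in> S ` C" "\<And>a. et a \<in> S ` C"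
    and f: "lin (smul A) (smul A) f" and fS: "\<And>b c. c \<in> C \<Longrightarrow> f (b \<cdot> S c) = f b \<cdot> S c"
    and c: "c \<in> C"
  shows "f (b \<cdot> c) = f b \<cdot> c"
proof -
  have lin_comp: "lin (smul A) (smul A) f' \<Longrightarrow> lin (smul A) (smul A) (\<lambda>x. f (f' x))" for f'
    by (rule lin_compose[OF f])
  note ints' = ints lin_comp
  have fsw: "f (sw (smul A) a g) = sw (smul A) a (\<lambda>x y. f (g x y))" for a g
    by (rule lin_sw_out[OF f])
  have feps: "f (b \<cdot> es a) = f b \<cdot> es a" "f (b \<cdot> et a) = f b \<cdot> et a" for a b
    using eps[of a] fS by auto
  have b1: "bil (smul A) (smul A) (\<lambda>x y. f (b \<cdot> x) \<cdot> S y)"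
    and b2: "bil (smul A) (smul A) (\<lambda>x y. f (b \<cdot> (x \<cdot> S y)))"
    and t1: "tril (smul A) (smul A) (\<lambda>x y z. f (b \<cdot> x) \<cdot> (S y \<cdot> z))"
    and b3: "bil (smul A) (smul A) (\<lambda>x z. sw (smul A) x (\<lambda>x y. f (b \<cdot> x) \<cdot> S y) \<cdot> z)"
    and b4: "bil (smul A) (smul A) (\<lambda>x z. sw (smul A) x (\<lambda>x y. f (b \<cdot> (x \<cdot> S y))) \<cdot> z)"
    by (intro ints')+
  have inner: "sw (smul A) x (\<lambda>x y. f (b \<cdot> x) \<cdot> S y) = sw (smul A) x (\<lambda>x y. f (b \<cdot> (x \<cdot> S y)))"
    if "x \<in> C" for x
    by (rule subcoalgebraD[OF C that b1 b2]) (simp add: fS mul_assoc[symmetric])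
  have "f (b \<cdot> c) = sw (smul A) c (\<lambda>x y. f (b \<cdot> x) \<cdot> es y)"
    using arg_cong[OF mul_es_id[of c], of "\<lambda>x. f (b \<cdot> x)"]
    by (simp add: mul_sw fsw feps mul_assoc[symmetric])
  also have "\<dots> = sw (smul A) c (\<lambda>x w. sw (smul A) w (\<lambda>y z. f (b \<cdot> x) \<cdot> (S y \<cdot> z)))"
    by (simp only: mul_sw[symmetric] S_mul)
  also have "\<dots> = sw (smul A) c (\<lambda>w z. sw (smul A) w (\<lambda>x y. f (b \<cdot> x) \<cdot> S y) \<cdot> z)"
    by (simp add: sw_coassoc[OF t1, symmetric] mul_sw mul_assoc)
  \<comment> \<open>The equation \<open>inner\<close> is available only on \<open>C\<close>, hence
    \<open>subcoalgebraD\<close> in place of rewriting under the sum.\<close>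
  also have "\<dots> = sw (smul A) c (\<lambda>w z. sw (smul A) w (\<lambda>x y. f (b \<cdot> (x \<cdot> S y))) \<cdot> z)"
    by (rule subcoalgebraD[OF C c b3 b4]) (simp only: inner)
  also have "\<dots> = sw (smul A) c (\<lambda>w z. f b \<cdot> et w \<cdot> z)"
    by (simp only: fsw[symmetric] mul_sw[symmetric] mul_S feps)
  also have "\<dots> = f b \<cdot> c"
    using arg_cong[OF et_mul_id[of c], of "\<lambda>x. f b \<cdot> x"] by (simp add: mul_sw mul_assoc)
  finally show ?thesis .
qed

text \<open>The descent ends at \<open>S ^^ 0\<close>, whose range is the whole algebra.\<close>

lemma right_linear_range_S:
  assumes f: "lin (smul A) (smul A) f" and fS: "\<And>b c. c \<in> range (S ^^ n) \<Longrightarrow> f (b \<cdot> c) = f b \<cdot> c"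
  shows "f (b \<cdot> c) = f b \<cdot> c"
  using fS
proof (induction n arbitrary: b c)
  case (Suc n)
  have "f (b \<cdot> c) = f b \<cdot> c" if "c \<in> range (S ^^ n)" for b c
  proof (rule right_linear_step[OF subcoalgebra_range_S[of n] _ _ f _ that])
    show "es a \<in> S ` range (S ^^ n)" "et a \<in> S ` range (S ^^ n)" for a
      using eps_in_range[of a "Suc n"] by (simp_all add: image_comp)
    show "f (b \<cdot> S c) = f b \<cdot> S c" if "c \<in> range (S ^^ n)" for b c
      using that by (intro Suc.prems) auto
  qed
  then show ?case by (rule Suc.IH)
qed auto

lemma bij_S: "bij S"
proof -
  obtain B where B: "finite B" "module.span (smul A) B = UNIV"
    using weak_bialgebra by (auto simp: weak_bialgebra_def fin_dim_space_def)
  \<comment> \<open>Even powers of \<open>S\<close> preserve the order of products, so they are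
    algebra maps.\<close>
  define T where "T = S \<circ> S"
  have lT: "lin (smul A) (smul A) T" using lin_compose[OF lin_S lin_S] by (simp add: T_def comp_def)
  obtain n where n0: "0 < n" and n: "inj_on (T ^^ n) (range (T ^^ n))" "\<And>k. range (T ^^ (n + k)) = range (T ^^ n)"
    by (rule linear_funpow_range_stable[OF vs B lT]) blast
  define E where "E = T ^^ n"
  have E: "E = S ^^ (2 * n)" unfolding E_def T_def by (induction n) (auto simp: fun_eq_iff)
  have lE: "lin (smul A) (smul A) E" unfolding E by (rule lin_funpow_S)
  have E_mul: "E (a \<cdot> b) = E a \<cdot> E b" for a b
    unfolding E_def T_def by (induction n) (auto simp: S_anti)
  have E_one: "E \<one> = \<one>" unfolding E_def T_def by (induction n) (auto simp: S_one)
  have inj: "x = y" if "E x = E y" "x \<in> range E" "y \<in> range E" for x y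
    using n(1) that unfolding E_def[symmetric] by (auto simp: inj_on_def)
  have "range (E \<circ> E) = range E" using n(2)[of n] by (simp add: E_def funpow_add)
  then have "\<exists>c\<in>range E. E c = E a" for a by (metis (no_types, lifting) comp_apply imageE rangeI)
  \<comment> \<open>\<open>p\<close> is the projection onto \<open>range E\<close> along the kernel
    of \<open>E\<close>. As \<open>E\<close> is injective on its range, identities for
    \<open>p\<close> can be tested after applying \<open>E\<close>.\<close>
  then obtain p where p: "\<And>a. p a \<in> range E" "\<And>a. E (p a) = E a" by metis
  have add: "x + y \<in> range E" and scale: "c \<odot> x \<in> range E" and mul: "x \<cdot> y \<in> range E"
    if "x \<in> range E" "y \<in> range E" for x y c
    using that linD(3,4)[OF lE, symmetric] by (auto simp: E_mul[symmetric])
  have lp: "lin (smul A) (smul A) p"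
  proof (intro linI vs)
    show "p (x + y) = p x + p y" for x y by (rule inj) (auto intro!: p add simp: linD[OF lE] p)
    show "p (c \<odot> x) = c \<odot> p x" for c x by (rule inj) (auto intro!: p scale simp: linD[OF lE] p)
  qed
  have "p (b \<cdot> c) = p b \<cdot> c" if "c \<in> range E" for b c
    by (rule inj) (use that in \<open>auto intro!: p mul simp: E_mul p\<close>)
  then have right: "p (b \<cdot> c) = p b \<cdot> c" for b c
    unfolding E by (rule right_linear_range_S[OF lp])
  have "\<one> \<in> range E" using E_one by (metis rangeI)
  then have "p \<one> = \<one>" using inj[OF p(2) p(1)] by blast
  then have "p a = a" for a using right[of \<one> a] by simp
  then have surj: "range E = UNIV" using p(1) by (metis UNIV_eq_I)
  then have "inj E" using inj by (intro injI) auto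
  \<comment> \<open>Positivity of \<open>n\<close> gives the bijection \<open>E\<close> both an
    outer and an inner factor \<open>S\<close>, so \<open>S\<close> is surjective and
    injective.\<close>
  from n0 obtain m where "2 * n = Suc m" by (cases n) auto
  then have 1: "E = S \<circ> S ^^ m" and 2: "E = S ^^ m \<circ> S"
    unfolding E by (simp, metis funpow_Suc_right)
  have "x \<in> range S" for x
  proof -
    have "x \<in> range E" by (simp add: surj)
    then show ?thesis unfolding 1 by auto
  qed
  then have "surj S" by blast
  moreover have "inj S" using \<open>inj E\<close> unfolding 2 by (rule inj_on_imageI2)
  ultimately show ?thesis by (simp add: bij_def)
qed

section \<open>The inverse as a pode, and the conclusion\<close>

lemma pode_inv_S: "pode A (inv S)"
proof -
  have inj: "S x = S y \<Longrightarrow> x = y" for x y using bij_S by (simp add: bij_def inj_eq)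
  have S_inv: "S (inv S x) = x" for x using bij_S by (simp add: bij_def surj_f_inv_f)
  have lin: "lin (smul A) (smul A) (inv S)"
    by (intro linI vs; rule inj) (simp_all add: linD[OF lin_S] S_inv)
  have 1: "sw (smul A) a (\<lambda>x y. y \<cdot> inv S x) = eps_RR A a" for a
    by (rule inj) (simp only: S_sw S_anti S_inv mul_S S_eps_RR)
  have 2: "sw (smul A) a (\<lambda>x y. inv S y \<cdot> x) = eps_LL A a" for a
    by (rule inj) (simp only: S_sw S_anti S_inv S_mul S_eps_LL)
  \<comment> \<open>\<open>S\<close> turns the triple product into
    \<open>a_(1) S a_(2) a_(3)\<close>, which is \<open>et a_(1) a_(2) = a\<close>.\<close>
  have 3: "sw (smul A) a (\<lambda>b z. sw (smul A) b (\<lambda>x y. inv S z \<cdot> y \<cdot> inv S x)) = inv S a" for a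
  proof (rule inj)
    have "S (sw (smul A) a (\<lambda>b z. sw (smul A) b (\<lambda>x y. inv S z \<cdot> y \<cdot> inv S x)))
      = sw (smul A) a (\<lambda>b z. sw (smul A) b (\<lambda>x y. x \<cdot> S y) \<cdot> z)"
      by (simp only: S_sw S_anti S_inv mul_sw mul_assoc)
    also have "\<dots> = S (inv S a)" by (simp only: mul_S et_mul_id S_inv)
    finally show "S (sw (smul A) a (\<lambda>b z. sw (smul A) b (\<lambda>x y. inv S z \<cdot> y \<cdot> inv S x))) = S (inv S a)" .
  qed
  show ?thesis
    unfolding pode_def sweedler3_def using lin 1 2 3 by blast
qed

text \<open>\<open>sw_S\<close> makes both tensors agree on all bilinear forms, and these separate
  tensors.\<close>

lemma anti_comultiplicative_S: "anti_comultiplicative A S"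
  unfolding anti_comultiplicative_def
proof
  fix a
  have "(Delta_rep A (S a), sweedler fscale A (\<lambda>x y. gen (S y, S x)) a) \<in> teq2 (smul A)"
  proof (rule teq2_by_bilinear_forms[OF vs])
    fix g :: "'a \<Rightarrow> 'a \<Rightarrow> 'k" assume g: "bil (smul A) (*) g"
    have "flin (*) (\<lambda>(x, y). g x y) (Delta_rep A (S a)) = sw (*) a (\<lambda>x y. g (S y) (S x))"
      using sw_S[OF g, of a] by (simp add: sweedler_def)
    also have "\<dots> = flin (*) (\<lambda>(x, y). g x y) (sweedler fscale A (\<lambda>x y. gen (S y, S x)) a)"
      by (simp add: lin_sw_out[OF lin_flin[OF vector_space_field]] flin_gen[OF vector_space_field])
    finally show "flin (*) (\<lambda>(x, y). g x y) (Delta_rep A (S a)) =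
      flin (*) (\<lambda>(x, y). g x y) (sweedler fscale A (\<lambda>x y. gen (S y, S x)) a)" .
  qed
  then show "\<Delta> (S a) = tensor2 (smul A) (sweedler fscale A (\<lambda>x y. gen (S y, S x)) a)"
    unfolding Delta_class(2)[of "S a"] tensor2_def by (rule equiv_class_eq[OF equiv_teq2])
qed

lemma bialgebra_anti_automorphism_S: "bialgebra_anti_automorphism A S"
  by (simp add: bialgebra_anti_automorphism_def lin_S bij_S anti_multiplicative_def S_anti
      anti_comultiplicative_S)

end

theorem corollary8p5:
  fixes A :: "('k::field, 'a::ab_group_add) walg" and S :: "'a \<Rightarrow> 'a"
  assumes "weak_bialgebra A" and "bimonoidal A"
    and "Vector_Spaces.linear (smul A) (smul A) S"
  shows "(antipode A S \<longleftrightarrow> normal_pre_rigidity_map A S) \<and>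
    (antipode A S \<longrightarrow> bialgebra_anti_automorphism A S \<and> pode A (inv S))"
proof -
  interpret bimonoidal_weak_bialgebra A by unfold_locales fact+
  have "normal_pre_rigidity_map A S \<and> bialgebra_anti_automorphism A S \<and> pode A (inv S)"
    if "antipode A S"
  proof -
    interpret weak_hopf_algebra A S by unfold_locales fact
    show ?thesis
      using antipode_imp_normal bialgebra_anti_automorphism_S pode_inv_S by blast
  qed
  then show ?thesis using normal_imp_antipode by blast
qed

end
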